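(* Let $q$ be an odd prime power, let $A=\mathbb{F}_q[t]$, $k=\mathbb{F}_q(t)$, let $\alpha\in A$ be a square-free polynomial which is of odd degree or whose leading coefficient is not a square in $\mathbb{F}_q$, let $K=k(\sqrt{\alpha})$ and let $\mathbb{A}=A+A\sqrt{\alpha}$ be the integral closure of $A$ in $K$. Let $Q,N\in\mathbb{N}$ and let $(a_g)_{g\in\mathbb{A}}$ be any sequence of complex numbers. Then $$ \sum_{\substack{f\in \mathbb{A}\setminus\{0\}\\ \mathbf{N}(f)= q^Q}} \ \sum_{\substack{r \bmod f\\ (r,f)=1}} \left|\sum_{g \in \mathbf{B}(0, N)\cap \mathbb{A}} a_g \cdot e\left(\mathbf{Tr}\left(\frac{gr}{2\sqrt{\alpha}f}\right)\right)\right|^2 \ll \left(q^{2Q}+q^N\right) \sum_{g \in \mathbf{B}(0, N)\cap \mathbb{A}} |a_g|^2, $$ where the implied constant depends only on $q$ and $\deg(\alpha)$.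
   Context: Let $p$ be the characteristic of $\mathbb{F}_q$ and $\mathrm{Tr}:\mathbb{F}_q\to\mathbb{F}_p$ the trace map. Let $k_\infty=\mathbb{F}_q((1/t))$ be the completion of $k$ at $\infty$, with absolute value $|\sum_{i=-\infty}^n a_it^i|_\infty=q^n$ if $a_n\neq 0$ (and $|0|_\infty=0$). Define $E:\mathbb{F}_q\to\mathbb{C}^\times$ by $E(x)=\exp\left(\frac{2\pi i}{p}\mathrm{Tr}(x)\right)$ and the additive character $e:k_\infty\to\mathbb{C}^\times$ by $e\left(\sum_{i=-\infty}^n a_it^i\right)=E(a_{-1})$. $\mathbf{Tr}:K\to k$ is the field trace, $\mathbf{Tr}(a+b\sqrt{\alpha})=2a$ for $a,b\in k$. Under the assumptions on $\alpha$ there is a single place of $K$ above $\infty$; $K_\infty$ denotes the completion of $K$ at it, and the absolute value of $k_\infty$ extends uniquely to an absolute value $|\cdot|_\infty$ on $K_\infty$. For $f\in K_\infty$ put $\mathbf{N}(f)=|f|_\infty^2$; thus for nonzero $f=a+b\sqrt{\alpha}\in\mathbb{A}$ with $a,b\in A$, $\mathbf{N}(f)=q^{\deg(a^2-b^2\alpha)}$. For $f\in K_\infty$ and $N\in\mathbb{R}$, $\mathbf{B}(f,N)=\{g\in K_\infty:\mathbf{N}(g-f)\le q^N\}$. The sum over $r \bmod f$ with $(r,f)=1$ runs over representatives $r\in\mathbb{A}$ of the residue classes in $\mathbb{A}/(f)$ which are units in $\mathbb{A}/(f)$, i.e. $r\mathbb{A}+f\mathbb{A}=\mathbb{A}$;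 the summand does not depend on the choice of representatives. *)

theory Defs
  imports
    Complex_Main
    "HOL-Library.Cardinality"
    "HOL-Computational_Algebra.Computational_Algebra"
    "HOL-Algebra.QuotRing"
begin

unbundle fps_syntax

text \<open>
  Throughout, \<open>'a\<close> is the finite field with \<open>q = CARD('a)\<close> elements, of
  characteristic \<open>p = CHAR('a)\<close>; \<open>A\<close> is \<open>'a poly\<close>, \<open>k\<close> is \<open>'a poly fract\<close> and
  \<open>k\<^sub>\<infinity> = 'a((1/t))\<close> is \<open>'a fls\<close>, \<^emph>\<open>whose formal variable stands for\<close> \<open>1/t\<close>: the
  coefficient of \<open>t^i\<close> in \<open>x\<close> is \<open>x $$ (-i)\<close>, and \<open>t\<close> itself is \<^term>\<open>fls_X_inv\<close>.
\<close>

subsection \<open>The field \<open>k\<^sub>\<infinity>\<close> and its additive character\<close>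

definition poly_to_fls :: "'a::field poly \<Rightarrow> 'a fls" where
  "poly_to_fls f = poly (map_poly fls_const f) fls_X_inv"

lemma poly_to_fls_0 [simp]: "poly_to_fls 0 = 0"
  by (simp add: poly_to_fls_def)

lemma poly_to_fls_pCons: "poly_to_fls (pCons c f) = fls_const c + fls_X_inv * poly_to_fls f"
  by (simp add: poly_to_fls_def map_poly_pCons)

lemma poly_to_fls_nth: "poly_to_fls f $$ i = (if i \<le> 0 then coeff f (nat (-i)) else 0)"
proof (induction f arbitrary: i)
  case (pCons c f)
  have "nat (-i) = Suc (nat (-(i+1)))" if "i < 0" using that by simp
  then show ?case
    by (auto simp: poly_to_fls_pCons pCons.IH fls_X_inv_times_conv_shift coeff_pCons
        split: nat.splits)
qed simp

lemma poly_to_fls_add: "poly_to_fls (f + g) = poly_to_fls f + poly_to_fls g"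
  by (rule fls_eqI) (simp add: poly_to_fls_nth)

lemma poly_to_fls_smult: "poly_to_fls (smult c f) = fls_const c * poly_to_fls f"
  by (rule fls_eqI) (simp add: poly_to_fls_nth)

lemma poly_to_fls_mult: "poly_to_fls (f * g) = poly_to_fls f * poly_to_fls g"
  by (induction f)
     (simp_all add: poly_to_fls_add poly_to_fls_smult poly_to_fls_pCons algebra_simps)

lemma poly_to_fls_eq_0_iff [simp]: "poly_to_fls f = 0 \<longleftrightarrow> f = 0"
proof
  assume "poly_to_fls f = 0"
  then have "coeff f n = 0" for n
    using poly_to_fls_nth[of f "- int n"] by simp
  then show "f = 0" by (simp add: poly_eq_iff)
qed simp

definition fract_to_fls :: "'a::field poly fract \<Rightarrow> 'a fls" where
  "fract_to_fls x = (THE y. \<exists>f g. g \<noteq> 0 \<and> x = Fract f g \<and> y = poly_to_fls f / poly_to_fls g)"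

lemma fract_to_fls_Fract: "g \<noteq> 0 \<Longrightarrow> fract_to_fls (Fract f g) = poly_to_fls f / poly_to_fls g"
  unfolding fract_to_fls_def
  by (rule the_equality) (auto simp: eq_fract frac_eq_eq simp flip: poly_to_fls_mult)

definition kinf_abs :: "'a::finite_field fls \<Rightarrow> real" where
  "kinf_abs x = (if x = 0 then 0 else real CARD('a) powi (- fls_subdegree x))"

text \<open>The trace of \<open>x\<close> to the prime field is the sum of its conjugates \<open>x^(p^i)\<close>.\<close>

definition prime_trace :: "'a::finite_field \<Rightarrow> 'a" where
  "prime_trace x = (\<Sum>i < (THE n. CARD('a) = CHAR('a) ^ n). x ^ (CHAR('a) ^ i))"

text \<open>
  The trace lies in the image of \<open>\<int>/p\<close>, so \<open>m\<close> below is its representative in \<open>{0..<p}\<close>.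
\<close>

definition fq_char :: "'a::finite_field \<Rightarrow> complex" where
  "fq_char x = exp (2 * of_real pi * \<i> / of_nat CHAR('a) *
     of_nat (THE m. m < CHAR('a) \<and> of_nat m = prime_trace x))"

definition kinf_char :: "'a::finite_field fls \<Rightarrow> complex" where
  "kinf_char x = fq_char (x $$ 1)"


subsection \<open>Adjoining a square root\<close>

text \<open>
  \<open>R[X]/(X^2 - \<delta>)\<close>, the pair \<open>(a, b)\<close> standing for \<open>a + b\<surd>\<delta>\<close>.
\<close>

definition quad_ring :: "'r::comm_ring_1 \<Rightarrow> ('r \<times> 'r) ring" where
  "quad_ring \<delta> = \<lparr> carrier = UNIV,
     monoid.mult = (\<lambda>(a, b) (c, d). (a * c + \<delta> * b * d, a * d + b * c)),
     one = (1, 0),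
     ring.zero = (0, 0),
     add = (\<lambda>(a, b) (c, d). (a + c, b + d)) \<rparr>"

text \<open>
  The trace over the base ring: the sum of the diagonal entries of the matrix of
  multiplication by \<open>x\<close> in the basis \<open>1, \<surd>\<delta>\<close>.
\<close>

definition quad_trace :: "'r::comm_ring_1 \<Rightarrow> 'r \<times> 'r \<Rightarrow> 'r" where
  "quad_trace \<delta> x = fst (x \<otimes>\<^bsub>quad_ring \<delta>\<^esub> (1, 0)) + snd (x \<otimes>\<^bsub>quad_ring \<delta>\<^esub> (0, 1))"

lemma quad_trace: "quad_trace \<delta> (a, b) = 2 * a"
  by (simp add: quad_trace_def quad_ring_def)

lemma cring_quad_ring: "cring (quad_ring \<delta>)"
proof (rule cringI)
  show "abelian_group (quad_ring \<delta>)"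
  proof (rule abelian_groupI)
    show "\<exists>y\<in>carrier (quad_ring \<delta>). y \<oplus>\<^bsub>quad_ring \<delta>\<^esub> x = \<zero>\<^bsub>quad_ring \<delta>\<^esub>" for x :: "'a \<times> 'a"
      by (rule bexI[of _ "(- fst x, - snd x)"]) (auto simp: quad_ring_def split: prod.split)
  qed (auto simp: quad_ring_def)
  show "comm_monoid (quad_ring \<delta>)"
    by (rule comm_monoidI) (auto simp: quad_ring_def algebra_simps)
qed (auto simp: quad_ring_def algebra_simps)

lemma field_quad_ring:
  fixes \<delta> :: "'k::Fields.field"
  assumes "\<nexists>c. \<delta> = c ^ 2"
  shows "Ring.field (quad_ring \<delta>)"
proof -
  interpret cring "quad_ring \<delta>" by (rule cring_quad_ring)
  show ?thesis
  proof (rule cring_fieldI2)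
    show "\<zero>\<^bsub>quad_ring \<delta>\<^esub> \<noteq> \<one>\<^bsub>quad_ring \<delta>\<^esub>" by (simp add: quad_ring_def)
    fix x :: "'k \<times> 'k" assume nz: "x \<noteq> \<zero>\<^bsub>quad_ring \<delta>\<^esub>"
    obtain a b where x: "x = (a, b)" by (cases x)
    define n where "n = a\<^sup>2 - \<delta> * b\<^sup>2"
    have "n \<noteq> 0"
    proof
      assume n: "n = 0"
      show False
      proof (cases "b = 0")
        case True
        with n nz x show False by (simp add: n_def quad_ring_def)
      next
        case False
        with n have "\<delta> = (a / b)\<^sup>2" by (simp add: n_def field_simps)
        with assms show False by blast
      qed
    qed
    then have "a * (a / n) + \<delta> * b * (- b / n) = 1"
      by (simp add: field_simps) (simp add: n_def power2_eq_square)
    then have "x \<otimes>\<^bsub>quad_ring \<delta>\<^esub> (a / n, - b / n) = \<one>\<^bsub>quad_ring \<delta>\<^esub>"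
      by (simp add: x quad_ring_def)
    then show "\<exists>y\<in>carrier (quad_ring \<delta>). x \<otimes>\<^bsub>quad_ring \<delta>\<^esub> y = \<one>\<^bsub>quad_ring \<delta>\<^esub>"
      by (auto simp: quad_ring_def)
  qed
qed


subsection \<open>The order \<open>A + A\<surd>\<alpha>\<close>, its field of fractions and the completion at infinity\<close>

definition AA :: "'a::field poly \<Rightarrow> ('a poly \<times> 'a poly) ring" where
  "AA \<alpha> = quad_ring \<alpha>"

definition KK :: "'a::field poly \<Rightarrow> ('a poly fract \<times> 'a poly fract) ring" where
  "KK \<alpha> = quad_ring (to_fract \<alpha>)"

text \<open>
  When \<open>\<alpha>\<close> is not a square in \<open>k\<^sub>\<infinity>\<close> there is a single place of \<open>K\<close> above infinity,
  and the completion there is \<open>K \<otimes>\<^sub>k k\<^sub>\<infinity> = k\<^sub>\<infinity>(\<surd>\<alpha>)\<close>.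
\<close>

definition KKinf :: "'a::field poly \<Rightarrow> ('a fls \<times> 'a fls) ring" where
  "KKinf \<alpha> = quad_ring (poly_to_fls \<alpha>)"

definition AA_to_KK :: "'a::field poly \<times> 'a poly \<Rightarrow> 'a poly fract \<times> 'a poly fract" where
  "AA_to_KK = map_prod to_fract to_fract"

definition AA_to_KKinf :: "'a::field poly \<times> 'a poly \<Rightarrow> 'a fls \<times> 'a fls" where
  "AA_to_KKinf = map_prod poly_to_fls poly_to_fls"

definition absolute_value :: "('b, 'm) ring_scheme \<Rightarrow> ('b \<Rightarrow> real) \<Rightarrow> bool" where
  "absolute_value R v \<longleftrightarrow>
     (\<forall>x\<in>carrier R. 0 \<le> v x \<and> (v x = 0 \<longleftrightarrow> x = \<zero>\<^bsub>R\<^esub>)) \<and>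
     (\<forall>x\<in>carrier R. \<forall>y\<in>carrier R. v (x \<otimes>\<^bsub>R\<^esub> y) = v x * v y \<and> v (x \<oplus>\<^bsub>R\<^esub> y) \<le> v x + v y)"

definition KKinf_abs :: "'a::finite_field poly \<Rightarrow> 'a fls \<times> 'a fls \<Rightarrow> real" where
  "KKinf_abs \<alpha> = (THE v. absolute_value (KKinf \<alpha>) v \<and> (\<forall>x. v (x, 0) = kinf_abs x))"

text \<open>
  The description in \<^const>\<open>KKinf_abs\<close> is shown below to have exactly one solution when \<open>\<alpha> \<noteq> 0\<close>
  has odd degree or non-square leading coefficient.
\<close>

lemma kinf_abs_mult: "kinf_abs (x * y) = kinf_abs x * kinf_abs y"
  for x y :: "'a::finite_field fls"
  by (simp add: kinf_abs_def power_int_add algebra_simps flip: power_int_add)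

lemma kinf_abs_nonneg [simp]: "0 \<le> kinf_abs x"
  by (simp add: kinf_abs_def)

lemma kinf_abs_eq_0_iff [simp]: "kinf_abs x = 0 \<longleftrightarrow> x = 0"
  by (simp add: kinf_abs_def)

lemma kinf_abs_0 [simp]: "kinf_abs 0 = 0"
  by (simp add: kinf_abs_def)

lemma card_finite_field_gt_1: "1 < real CARD('a::finite_field)"
proof -
  have "card {0, 1 :: 'a} \<le> CARD('a)" by (rule card_mono) auto
  then show ?thesis by simp
qed

lemma kinf_abs_antimono:
  "kinf_abs x \<le> kinf_abs y" if "x \<noteq> 0" "y \<noteq> 0" "fls_subdegree y \<le> fls_subdegree x"
  for x y :: "'a::finite_field fls"
  using that card_finite_field_gt_1[where 'a = 'a]
  by (simp add: kinf_abs_def power_int_increasing)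

lemma kinf_abs_add: "kinf_abs (x + y) \<le> max (kinf_abs x) (kinf_abs y)"
  for x y :: "'a::finite_field fls"
proof (cases "x = 0 \<or> y = 0 \<or> x + y = 0")
  case True
  then show ?thesis by (auto simp: le_max_iff_disj)
next
  case False
  then have "min (fls_subdegree x) (fls_subdegree y) \<le> fls_subdegree (x + y)"
    by (intro fls_plus_subdegree) auto
  then show ?thesis
    using False kinf_abs_antimono[of "x + y" x] kinf_abs_antimono[of "x + y" y]
    by (auto simp: min_le_iff_disj le_max_iff_disj)
qed

lemma kinf_abs_poly: "f \<noteq> 0 \<Longrightarrow> kinf_abs (poly_to_fls f) = real CARD('a) ^ degree f"
  for f :: "'a::finite_field poly"
proof -
  assume f: "f \<noteq> 0"
  have "fls_subdegree (poly_to_fls f) = - int (degree f)"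
    by (rule fls_subdegree_eqI) (use f in \<open>auto simp: poly_to_fls_nth intro!: coeff_eq_0\<close>)
  with f show ?thesis by (simp add: kinf_abs_def)
qed

context
  fixes \<alpha> :: "'a::finite_field poly"
  assumes nz: "\<alpha> \<noteq> 0" and ram: "odd (degree \<alpha>) \<or> (\<nexists>c. lead_coeff \<alpha> = c\<^sup>2)"
begin

lemma kinf_abs_norm:
  "kinf_abs (x\<^sup>2 - poly_to_fls \<alpha> * y\<^sup>2) = max ((kinf_abs x)\<^sup>2) (kinf_abs (poly_to_fls \<alpha>) * (kinf_abs y)\<^sup>2)"
proof -
  define \<delta> where "\<delta> = poly_to_fls \<alpha>"
  have d0: "\<delta> \<noteq> 0" using nz by (simp add: \<delta>_def)
  have sd: "fls_subdegree \<delta> = - int (degree \<alpha>)" unfolding \<delta>_def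
    by (rule fls_subdegree_eqI) (use nz in \<open>auto simp: poly_to_fls_nth intro!: coeff_eq_0\<close>)
  have ld: "\<delta> $$ (- int (degree \<alpha>)) = lead_coeff \<alpha>"
    by (simp add: \<delta>_def poly_to_fls_nth)
  have neg: "kinf_abs (- z) = kinf_abs z" for z :: "'a fls" by (simp add: kinf_abs_def)
  have mx: "max ((kinf_abs x)\<^sup>2) (kinf_abs \<delta> * (kinf_abs y)\<^sup>2) = max (kinf_abs (x\<^sup>2)) (kinf_abs (\<delta> * y\<^sup>2))"
    by (simp add: power2_eq_square kinf_abs_mult)
  show ?thesis
  proof (cases "x = 0 \<or> y = 0")
    case True
    then show ?thesis unfolding \<delta>_def[symmetric] mx
      by (auto simp: neg)
  next
    case False
    define u where "u = x\<^sup>2"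
    define w where "w = \<delta> * y\<^sup>2"
    have u0: "u \<noteq> 0" "w \<noteq> 0" using False d0 by (auto simp: u_def w_def)
    have su: "fls_subdegree u = 2 * fls_subdegree x" using False by (simp add: u_def fls_subdegree_pow)
    have sw: "fls_subdegree w = 2 * fls_subdegree y - int (degree \<alpha>)"
      using False d0 by (simp add: w_def fls_subdegree_pow sd)
    have "u - w \<noteq> 0 \<and> fls_subdegree (u - w) = min (fls_subdegree u) (fls_subdegree w)"
    proof (cases "fls_subdegree u" "fls_subdegree w" rule: linorder_cases)
      case less
      then show ?thesis using u0 by (auto simp: fls_subdegree_diff_eq1)
    next
      case greater
      then show ?thesis using u0 by (auto simp: fls_subdegree_diff_eq2)
    next
      case equal
      define m where "m = fls_subdegree u"
      have "even (degree \<alpha>)" using equal su sw by presburger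
      with ram have ns: "\<nexists>c. lead_coeff \<alpha> = c\<^sup>2" by blast
      have "u $$ m = (x $$ fls_subdegree x)\<^sup>2"
        using su fls_times_base[of x x] by (simp add: m_def u_def power2_eq_square)
      moreover have "w $$ m = lead_coeff \<alpha> * (y $$ fls_subdegree y)\<^sup>2"
        using sw equal fls_times_base[of \<delta> "y * y"] fls_times_base[of y y] False d0
        by (simp add: m_def w_def power2_eq_square sd ld)
      moreover have "y $$ fls_subdegree y \<noteq> 0" using False by simp
      ultimately have nzm: "(u - w) $$ m \<noteq> 0"
        using ns by (auto simp: field_simps power_divide)
          (metis nonzero_eq_divide_eq power_divide power_not_zero)
      have "fls_subdegree (u - w) = m"
        by (rule fls_subdegree_eqI[OF nzm]) (use equal in \<open>simp add: m_def\<close>)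
      with nzm equal show ?thesis by (auto simp: m_def)
    qed
    then show ?thesis unfolding \<delta>_def[symmetric] mx u_def[symmetric] w_def[symmetric]
      using u0 kinf_abs_antimono[of u w] kinf_abs_antimono[of w u]
      by (cases "fls_subdegree u \<le> fls_subdegree w") (auto simp: kinf_abs_def)
  qed
qed

lemma KKinf_abs_unique:
  "absolute_value (KKinf \<alpha>) v \<and> (\<forall>x. v (x, 0) = kinf_abs x) \<longleftrightarrow>
     v = (\<lambda>z. sqrt (kinf_abs ((fst z)\<^sup>2 - poly_to_fls \<alpha> * (snd z)\<^sup>2)))"
proof -
  define \<delta> where "\<delta> = poly_to_fls \<alpha>"
  have d0: "kinf_abs \<delta> > 0" using nz by (simp add: \<delta>_def order_less_le)
  define w where "w = (\<lambda>z. sqrt (kinf_abs ((fst z)\<^sup>2 - \<delta> * (snd z)\<^sup>2)))"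
  have w_max: "w (x, y) = max (kinf_abs x) (sqrt (kinf_abs \<delta>) * kinf_abs y)" for x y
    using kinf_abs_norm[of x y]
    by (simp add: w_def \<delta>_def real_sqrt_mult max_def)
       (metis kinf_abs_nonneg real_sqrt_abs abs_of_nonneg real_sqrt_le_iff real_sqrt_mult)
  have w_0: "w z = 0 \<longleftrightarrow> z = (0, 0)" for z
  proof -
    obtain x y where z: "z = (x, y)" by (cases z)
    have "max r s = 0 \<longleftrightarrow> r = 0 \<and> s = 0" if "0 \<le> r" "0 \<le> s" for r s :: real
      using that by (auto simp: max_def)
    with d0 show ?thesis by (auto simp: z w_max)
  qed
  have w_nonneg: "0 \<le> w z" for z by (simp add: w_def)
  have w_mult: "w (z \<otimes>\<^bsub>KKinf \<alpha>\<^esub> z') = w z * w z'" for z z'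
  proof -
    obtain a b c d where z: "z = (a, b)" "z' = (c, d)" by (cases z, cases z')
    have "(a * c + \<delta> * b * d)\<^sup>2 - \<delta> * (a * d + b * c)\<^sup>2 = (a\<^sup>2 - \<delta> * b\<^sup>2) * (c\<^sup>2 - \<delta> * d\<^sup>2)"
      by (simp add: power2_eq_square algebra_simps)
    then show ?thesis
      by (simp add: z w_def KKinf_def quad_ring_def \<delta>_def[symmetric] kinf_abs_mult real_sqrt_mult)
  qed
  have w_add: "w (z \<oplus>\<^bsub>KKinf \<alpha>\<^esub> z') \<le> w z + w z'" for z z'
  proof -
    obtain a b c d where z: "z = (a, b)" "z' = (c, d)" by (cases z, cases z')
    define s where "s = sqrt (kinf_abs \<delta>)"
    have s: "0 \<le> s" by (simp add: s_def)
    have "kinf_abs (a + c) \<le> kinf_abs a + kinf_abs c"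
      using kinf_abs_add[of a c] kinf_abs_nonneg[of a] kinf_abs_nonneg[of c] by linarith
    moreover have "kinf_abs (b + d) \<le> kinf_abs b + kinf_abs d"
      using kinf_abs_add[of b d] kinf_abs_nonneg[of b] kinf_abs_nonneg[of d] by linarith
    then have "s * kinf_abs (b + d) \<le> s * kinf_abs b + s * kinf_abs d"
      using s by (metis distrib_left mult_left_mono)
    ultimately show ?thesis
      by (simp add: z w_max KKinf_def quad_ring_def flip: s_def) linarith
  qed
  have w_ext: "w (x, 0) = kinf_abs x" for x by (simp add: w_max)
  have one: "w (1, 0) = 1" unfolding w_ext by (simp add: kinf_abs_def)
  have "absolute_value (KKinf \<alpha>) v \<and> (\<forall>x. v (x, 0) = kinf_abs x) \<longleftrightarrow> v = w"
  proof
    assume "v = w"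
    then show "absolute_value (KKinf \<alpha>) v \<and> (\<forall>x. v (x, 0) = kinf_abs x)"
      using w_0 w_nonneg w_mult w_add w_ext
      by (simp add: absolute_value_def) (simp add: KKinf_def quad_ring_def)
  next
    assume v: "absolute_value (KKinf \<alpha>) v \<and> (\<forall>x. v (x, 0) = kinf_abs x)"
    have UN: "carrier (KKinf \<alpha>) = UNIV" and zr: "\<zero>\<^bsub>KKinf \<alpha>\<^esub> = (0, 0)"
      by (simp_all add: KKinf_def quad_ring_def)
    have v_nonneg: "0 \<le> v z" and v_0: "v z = 0 \<longleftrightarrow> z = (0, 0)"
      and v_mult: "v (z \<otimes>\<^bsub>KKinf \<alpha>\<^esub> z') = v z * v z'"
      and v_add: "v (z \<oplus>\<^bsub>KKinf \<alpha>\<^esub> z') \<le> v z + v z'" for z z'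
      using v by (simp_all add: absolute_value_def UN zr del: split_paired_All)
    have v_ext: "v (x, 0) = kinf_abs x" for x using v by blast
    have "(v (0, 1))\<^sup>2 = kinf_abs \<delta>"
      using v_mult[of "(0, 1)" "(0, 1)"] v_ext[of \<delta>]
      by (simp add: power2_eq_square KKinf_def quad_ring_def \<delta>_def)
    then have v_sqrt: "v (0, 1) = sqrt (kinf_abs \<delta>)"
      using v_nonneg by (metis real_sqrt_abs abs_of_nonneg)
    have bound: "v z \<le> 2 * w z" for z
    proof -
      obtain x y where z: "z = (x, y)" by (cases z)
      have "(x, 0) \<oplus>\<^bsub>KKinf \<alpha>\<^esub> ((y, 0) \<otimes>\<^bsub>KKinf \<alpha>\<^esub> (0, 1)) = z"
        by (simp add: z KKinf_def quad_ring_def)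
      then have "v z \<le> v (x, 0) + v (y, 0) * v (0, 1)"
        by (metis v_add v_mult)
      also have "\<dots> = kinf_abs x + sqrt (kinf_abs \<delta>) * kinf_abs y"
        by (simp add: v_ext v_sqrt)
      also have "\<dots> \<le> 2 * w z" by (simp add: z w_max)
      finally show ?thesis .
    qed
    have le: "v z \<le> w z" for z
    proof (rule ccontr)
      assume less: "\<not> v z \<le> w z"
      then have "z \<noteq> (0, 0)" using v_0[of z] w_0[of z] by linarith
      then have wpos: "w z > 0" using w_0 w_nonneg by (metis order_less_le)
      define pw where "pw = (\<lambda>n. ((\<lambda>y. z \<otimes>\<^bsub>KKinf \<alpha>\<^esub> y) ^^ n) (1, 0))"
      have pw: "v (pw n) = v z ^ n" "w (pw n) = w z ^ n" for n
        by (induction n) (simp_all add: pw_def v_mult w_mult v_ext one kinf_abs_def)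
      have "1 < v z / w z" using less wpos by simp
      then obtain n where "2 < (v z / w z) ^ n" using real_arch_pow by blast
      then have "2 * w z ^ n < v z ^ n" using wpos by (simp add: power_divide field_simps)
      with bound[of "pw n"] show False by (simp add: pw)
    qed
    have ge: "w z \<le> v z" if "z \<noteq> (0, 0)" for z
    proof -
      obtain a b where z: "z = (a, b)" by (cases z)
      define n where "n = a\<^sup>2 - \<delta> * b\<^sup>2"
      have "w z \<noteq> 0" using that w_0 by simp
      then have n0: "n \<noteq> 0" by (auto simp: w_def z n_def)
      define z' where "z' = (a / n, - b / n)"
      have "a * (a / n) + \<delta> * b * (- b / n) = 1"
        using n0 by (simp add: n_def power2_eq_square flip: diff_divide_distrib)
      then have zz: "z \<otimes>\<^bsub>KKinf \<alpha>\<^esub> z' = (1, 0)"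
        by (simp add: z z'_def KKinf_def quad_ring_def \<delta>_def)
      have "w z * w z' = 1" using w_mult[of z z'] zz one by simp
      moreover have "v z * v z' = 1" using v_mult[of z z'] zz v_ext[of 1] by (simp add: kinf_abs_def)
      moreover have "v z * v z' \<le> v z * w z'" using le v_nonneg by (simp add: mult_left_mono)
      moreover have "w z' > 0" using \<open>w z * w z' = 1\<close> w_nonneg[of z']
        by (metis mult_zero_right order_less_le zero_neq_one)
      ultimately show ?thesis by (metis mult_le_cancel_right_pos)
    qed
    show "v = w"
    proof
      fix z show "v z = w z"
        using le[of z] ge[of z] v_0[of z] w_0[of z] by linarith
    qed
  qed
  then show ?thesis by (simp add: w_def \<delta>_def)
qed

lemma ex1_KKinf_abs:
  "\<exists>!v. absolute_value (KKinf \<alpha>) v \<and> (\<forall>x. v (x, 0) = kinf_abs x)"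
  by (simp add: KKinf_abs_unique)

lemma KKinf_abs: "KKinf_abs \<alpha> (x, y) = sqrt (kinf_abs (x\<^sup>2 - poly_to_fls \<alpha> * y\<^sup>2))"
  by (simp add: KKinf_abs_def KKinf_abs_unique)

end

definition NN :: "'a::finite_field poly \<Rightarrow> 'a fls \<times> 'a fls \<Rightarrow> real" where
  "NN \<alpha> f = (KKinf_abs \<alpha> f)\<^sup>2"

lemma NN_AA_to_KKinf:
  fixes \<alpha> a b :: "'a::finite_field poly"
  assumes "\<alpha> \<noteq> 0" "odd (degree \<alpha>) \<or> (\<nexists>c. lead_coeff \<alpha> = c\<^sup>2)" "(a, b) \<noteq> (0, 0)"
  shows "NN \<alpha> (AA_to_KKinf (a, b)) = real CARD('a) ^ degree (a\<^sup>2 - b\<^sup>2 * \<alpha>)"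
proof -
  have diff: "poly_to_fls (f - g) = poly_to_fls f - poly_to_fls g" for f g :: "'a poly"
    by (rule fls_eqI) (simp add: poly_to_fls_nth)
  have eq: "(poly_to_fls a)\<^sup>2 - poly_to_fls \<alpha> * (poly_to_fls b)\<^sup>2 = poly_to_fls (a\<^sup>2 - b\<^sup>2 * \<alpha>)"
    by (simp add: diff poly_to_fls_mult power2_eq_square)
  have "kinf_abs (poly_to_fls (a\<^sup>2 - b\<^sup>2 * \<alpha>)) \<noteq> 0"
    unfolding eq[symmetric] kinf_abs_norm[OF assms(1,2)]
    using assms by (auto simp: max_def)
  then have "a\<^sup>2 - b\<^sup>2 * \<alpha> \<noteq> 0" by auto
  then show ?thesis
    by (simp add: NN_def AA_to_KKinf_def KKinf_abs[OF assms(1,2)] eq kinf_abs_poly)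
qed

definition BB :: "'a::finite_field poly \<Rightarrow> 'a fls \<times> 'a fls \<Rightarrow> real \<Rightarrow> ('a fls \<times> 'a fls) set" where
  "BB \<alpha> f N = {g \<in> carrier (KKinf \<alpha>). NN \<alpha> (g \<ominus>\<^bsub>KKinf \<alpha>\<^esub> f) \<le> real CARD('a) powr N}"

text \<open>
  \<open>S\<close> contains exactly one representative of each unit of the quotient ring \<open>R/(f)\<close>.
\<close>

definition reduced_residue_system :: "('b, 'm) ring_scheme \<Rightarrow> 'b \<Rightarrow> 'b set \<Rightarrow> bool" where
  "reduced_residue_system R f S \<longleftrightarrow>
     S \<subseteq> carrier R \<and>
     bij_betw (\<lambda>r. PIdl\<^bsub>R\<^esub> f +>\<^bsub>R\<^esub> r) S (Units (R Quot (PIdl\<^bsub>R\<^esub> f)))"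

end

theory Submission
  imports Defs "HOL-Number_Theory.Cong" "HOL-Algebra.Sylow" "HOL-Library.Product_Plus"
begin

text \<open>
  For \<open>x\<close> in \<open>K\<close> let \<open>\<psi>(x) = e(Tr(x / (2\<surd>\<alpha>)))\<close>.  Writing \<open>x = u + v\<surd>\<alpha>\<close>, the trace is \<open>v\<close>, so
  \<open>\<psi>(x) = E(c)\<close> for the coefficient \<open>c\<close> of \<open>1/t\<close> in \<open>v\<close>; in particular \<open>\<psi>\<close> is trivial on the order \<open>A + A\<surd>\<alpha>\<close>.
  Each pair \<open>(f, r)\<close> gives the character \<open>g \<mapsto> \<psi>(g r / f)\<close> of the finite additive group
  \<open>V\<^sub>N = {g. N(g) \<le> q^N}\<close>, and the left-hand side is the sum of the squared inner products of \<open>a\<close>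
  with the conjugates of these characters.

  Distinct characters of a finite abelian group \<open>V\<close> are orthogonal, of squared length \<open>|V|\<close>.  Hence, if
  no character occurs more than \<open>M\<close> times, Bessel's inequality bounds the sum by \<open>M |V| \<Sum>|a|\<^sup>2\<close>
  (\<open>large_sieve_characters\<close>).  There are at most \<open>q^(N + 2)\<close> elements of norm at most \<open>q^N\<close>
  (\<open>card_norm_ball_le\<close>), so what remains is to bound \<open>M\<close>.

  Two different fractions \<open>r/f\<close>, \<open>r'/f'\<close> modulo the order, with denominators of norm \<open>q^Q\<close>, differ by
  an element of norm at least \<open>q^(-2Q)\<close>, since their difference has denominator \<open>ff'\<close>.  On the other
  hand, if their characters agree on \<open>V\<^sub>N\<close>, then, modulo the order, the difference has norm less than
  \<open>q^(deg \<alpha> - N)\<close>.  So for \<open>N \<ge> 2Q + deg \<alpha>\<close> equal characters force equal fractions (\<open>fractions_congruent_of_chars_eq\<close>).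
  Reduced fractions that agree modulo the order have associated denominators, and the unit between
  the denominators determines the second fraction; there are at most \<open>q\<^sup>2\<close> units, so
  \<open>M \<le> q\<^sup>2\<close> (\<open>card_equal_chars_le\<close>).

  If \<open>N\<close> is smaller than \<open>2Q + deg \<alpha>\<close>, extending \<open>a\<close> by zero to the larger ball leaves both sums
  unchanged.  So the bound holds with \<open>q^N\<close> replaced by \<open>q^(max N (2Q + deg \<alpha>))\<close>, which is at most
  \<open>q^(deg \<alpha>) (q^(2Q) + q^N)\<close> (\<open>large_sieve_quadratic\<close>).

  The second coordinate of \<open>g r / f\<close> is a quotient of polynomials with denominator the norm of \<open>f\<close>,
  which lets the spacing argument be carried out with degrees of remainders of polynomial division.
\<close>

section \<open>The additive character of a finite field\<close>

text \<open>
  If a prime \<open>l \<noteq> p\<close> divided the order of the field, a Sylow subgroup \<open>H\<close> of the additive group would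
  contain some \<open>x \<noteq> 0\<close>, and \<open>|H| x = 0\<close> contradicts that \<open>|H|\<close>, a power of \<open>l\<close>, is invertible.
  The result gives meaning to the definite description in \<^const>\<open>prime_trace\<close>.
\<close>
lemma ex_CARD_eq_CHAR_power: "\<exists>n>0. CARD('a::finite_field) = CHAR('a) ^ n"
proof -
  have CARD_ne_0: "CARD('a) \<noteq> 0" by simp
  define p where "p = CHAR('a)"
  have p: "prime p" by (simp add: p_def)
  define G :: "'a monoid" where "G = \<lparr>carrier = UNIV, monoid.mult = (+), one = 0\<rparr>"
  interpret G: group G
  proof (rule groupI)
    fix x assume "x \<in> carrier G"
    show "\<exists>y\<in>carrier G. y \<otimes>\<^bsub>G\<^esub> x = \<one>\<^bsub>G\<^esub>"
      by (rule bexI[of _ "- x"]) (simp_all add: G_def)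
  qed (simp_all add: G_def add.assoc)
  have fin: "finite (carrier G)" and ord: "order G = CARD('a)"
    by (simp_all add: G_def order_def)
  have only_p: "l = p" if l: "prime l" "l dvd CARD('a)" for l
  proof (rule ccontr)
    assume "l \<noteq> p"
    obtain k m where km: "CARD('a) = l ^ k * m" "\<not> l dvd m"
      using multiplicity_decompose'[of "CARD('a)" l] l
      by (metis CARD_ne_0 not_prime_unit)
    have k: "k > 0" using l km by (cases k) auto
    obtain H where H: "subgroup H G" "card H = l ^ k"
      using sylow_thm[OF l(1) G.is_group _ fin, of k m] ord km by auto
    have "card H > 1" using H k prime_gt_1_nat[OF l(1)] by (simp only: one_less_power)
    then have "\<not> H \<subseteq> {0}" using card_mono[of "{0 :: 'a}" H] by auto
    then obtain x where x: "x \<in> H" "x \<noteq> 0" by blast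
    interpret H: subgroup H G by (rule H)
    \<comment> \<open>Translation by \<open>x\<close> permutes \<open>H\<close>; comparing the sums of all elements gives \<open>|H| x = 0\<close>.\<close>
    have "(\<lambda>h. h + x) ` H = H"
    proof (rule card_seteq)
      show "(\<lambda>h. h + x) ` H \<subseteq> H" using H.m_closed x(1) by (auto simp: G_def)
      show "card H \<le> card ((\<lambda>h. h + x) ` H)" by (subst card_image) (auto simp: inj_on_def)
    qed simp
    then have "(\<Sum>h\<in>H. h) = (\<Sum>h\<in>H. h + x)"
      using sum.reindex[of "\<lambda>h. h + x" H "\<lambda>h. h"] by (simp add: inj_on_def o_def)
    then have "of_nat (l ^ k) * x = 0" using H by (simp add: sum.distrib)
    then have "of_nat (l ^ k) = (0 :: 'a)" using x by simp
    then have "p dvd l ^ k" by (simp only: of_nat_eq_0_iff_char_dvd p_def)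
    then show False
      using primes_dvd_imp_eq[OF p l(1) prime_dvd_power[OF p]] \<open>l \<noteq> p\<close> by blast
  qed
  obtain n m where nm: "CARD('a) = p ^ n * m" "\<not> p dvd m"
    using multiplicity_decompose'[of "CARD('a)" p] p
    by (metis CARD_ne_0 not_prime_unit)
  have "m = 1"
  proof (rule ccontr)
    assume "m \<noteq> 1"
    then obtain l where "prime l" "l dvd m" using prime_factor_nat by blast
    then show False using only_p[of l] nm by (simp only: dvd_mult)
  qed
  moreover have "n > 0"
    using nm \<open>m = 1\<close> card_finite_field_gt_1[where 'a = 'a] by (cases n) auto
  ultimately show ?thesis using nm by (auto simp: p_def)
qed

lemma prime_trace_eq:
  assumes "CARD('a::finite_field) = CHAR('a) ^ n"
  shows "prime_trace (x :: 'a) = (\<Sum>i<n. x ^ (CHAR('a) ^ i))"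
proof -
  have "(THE n. CARD('a) = CHAR('a) ^ n) = n"
    using assms prime_gt_1_nat[OF CHAR_prime[where 'a = 'a]] by (intro the_equality) auto
  then show ?thesis by (simp add: prime_trace_def)
qed

lemma prime_trace_add: "prime_trace (x + y) = prime_trace x + prime_trace (y :: 'a::finite_field)"
proof -
  obtain n where n: "CARD('a) = CHAR('a) ^ n" using ex_CARD_eq_CHAR_power by blast
  show ?thesis
    by (simp add: prime_trace_eq[OF n] freshmans_dream'[OF CHAR_prime refl] sum.distrib)
qed

text \<open>
  Frobenius permutes the conjugates cyclically, as \<open>x^q = x\<close>, so it fixes their sum.
\<close>
lemma prime_trace_power_CHAR: "prime_trace x ^ CHAR('a) = prime_trace (x :: 'a::finite_field)"
proof -
  obtain n where n: "CARD('a) = CHAR('a) ^ n" using ex_CARD_eq_CHAR_power by blast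
  define c where "c i = x ^ (CHAR('a) ^ i)" for i
  have "prime_trace x ^ CHAR('a) = (\<Sum>i<n. c (Suc i))"
    by (simp add: c_def prime_trace_eq[OF n] freshmans_dream_sum[OF CHAR_prime refl]
        power_mult[symmetric] mult.commute)
  moreover have "c 0 + (\<Sum>i<n. c (Suc i)) = (\<Sum>i<n. c i) + c n"
    using sum.lessThan_Suc_shift[of c n] sum.lessThan_Suc[of c n] by simp
  moreover have "c n = c 0"
    using finite_field_power_card_eq_same[of x] n by (simp add: c_def)
  moreover have "(\<Sum>i<n. c i) = prime_trace x"
    by (simp add: c_def prime_trace_eq[OF n])
  ultimately show ?thesis by simp
qed

text \<open>
  The polynomial \<open>X^p - X\<close> has at most \<open>p\<close> roots, and the \<open>p\<close> elements of the prime field are roots.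
  Together with \<open>prime_trace_power_CHAR\<close> this makes the integer in \<^const>\<open>fq_char\<close> well defined.
\<close>
lemma CHAR_power_fixed_point:
  assumes "(y :: 'a::finite_field) ^ CHAR('a) = y"
  shows "\<exists>!m. m < CHAR('a) \<and> of_nat m = y"
proof -
  define p where "p = CHAR('a)"
  have p: "prime p" by (simp add: p_def)
  define F where "F = (monom 1 p - monom 1 1 :: 'a poly)"
  have "coeff F p = 1" using prime_gt_1_nat[OF p] by (simp add: F_def)
  then have F0: "F \<noteq> 0" by auto
  have degF: "degree F \<le> p"
    using prime_gt_1_nat[OF p]
    by (auto simp: F_def intro!: degree_diff_le degree_monom_le order.trans[OF degree_monom_le])
  have frob: "(of_nat m :: 'a) ^ p = of_nat m" for m
  proof (induction m)
    case (Suc m)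
    then show ?case by (simp add: freshmans_dream[OF CHAR_prime refl] p_def)
  qed (use p in \<open>auto simp: prime_gt_0_nat\<close>)
  have inj: "inj_on (of_nat :: nat \<Rightarrow> 'a) {..<p}"
    by (rule inj_onI) (auto simp: of_nat_eq_iff_cong_CHAR cong_def p_def)
  have "of_nat ` {..<p} = {x. poly F x = 0}"
  proof (rule card_seteq)
    show "of_nat ` {..<p} \<subseteq> {x. poly F x = 0}" by (auto simp: F_def poly_monom frob)
    show "card {x. poly F x = 0} \<le> card (of_nat ` {..<p} :: 'a set)"
      using card_poly_roots_bound[OF F0] degF card_image[OF inj] by simp
  qed simp
  moreover have "poly F y = 0" using assms by (simp add: F_def poly_monom p_def)
  ultimately have "y \<in> of_nat ` {..<p}" by blast
  with inj show ?thesis by (auto simp: p_def inj_on_def)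
qed

text \<open>
  Any integer representative of the trace may be used, not only the one in \<open>{0..<p}\<close>; this makes
  additivity immediate.
\<close>
lemma fq_char_cis:
  fixes x :: "'a::finite_field"
  assumes "of_nat k = prime_trace x"
  shows "fq_char x = cis (2 * pi * real k / real CHAR('a))"
proof -
  define p where "p = CHAR('a)"
  have p: "p > 0" by (simp add: p_def)
  have "of_nat (k mod p) = prime_trace x"
    unfolding assms[symmetric] by (simp add: of_nat_eq_iff_cong_CHAR cong_def p_def)
  then have "(THE m. m < p \<and> of_nat m = prime_trace x) = k mod p"
    using CHAR_power_fixed_point[OF prime_trace_power_CHAR[of x]] p
    unfolding p_def by (intro the1_equality) simp_all
  then have "fq_char x = exp (2 * of_real pi * \<i> / of_nat p * of_nat (k mod p))"
    by (simp add: fq_char_def p_def)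
  also have "\<dots> = cis (2 * pi * real (k mod p) / real p)"
    by (simp add: cis_conv_exp mult_ac)
  also have "\<dots> = cis (2 * pi * real (k mod p) / real p) * cis (2 * pi * real (k div p))"
    by simp
  also have "\<dots> = cis (2 * pi * real k / real p)"
  proof -
    have "real k = real (k div p * p + k mod p)" by simp
    also have "2 * pi * \<dots> / real p = 2 * pi * real (k mod p) / real p + 2 * pi * real (k div p)"
      using p unfolding of_nat_add of_nat_mult by (simp add: field_simps)
    finally show ?thesis by (simp only: cis_mult)
  qed
  finally show ?thesis by (simp add: p_def)
qed

lemma ex_of_nat_prime_trace: "\<exists>k. k < CHAR('a) \<and> of_nat k = prime_trace (x :: 'a::finite_field)"
  using CHAR_power_fixed_point[OF prime_trace_power_CHAR[of x]] by blast

lemma fq_char_add: "fq_char (x + y) = fq_char x * fq_char (y :: 'a::finite_field)"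
proof -
  obtain k l :: nat where kl: "of_nat k = prime_trace x" "of_nat l = prime_trace y"
    using ex_of_nat_prime_trace[of x] ex_of_nat_prime_trace[of y] by blast
  have kl': "of_nat (k + l) = prime_trace (x + y)"
    using kl by (simp add: prime_trace_add)
  have "2 * pi * real (k + l) / real CHAR('a) =
      2 * pi * real k / real CHAR('a) + 2 * pi * real l / real CHAR('a)"
    by (simp only: of_nat_add ring_distribs add_divide_distrib)
  then show ?thesis
    by (simp only: fq_char_cis[OF kl'] fq_char_cis[OF kl(1)] fq_char_cis[OF kl(2)] cis_mult)
qed

lemma norm_fq_char [simp]: "cmod (fq_char x) = 1"
proof -
  obtain k where "of_nat k = prime_trace x" using ex_of_nat_prime_trace[of x] by blast
  then show ?thesis by (simp add: fq_char_cis)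
qed

text \<open>
  The trace is a polynomial function of degree \<open>p^(n - 1) < q\<close>, so it cannot vanish identically.
\<close>
lemma ex_prime_trace_nonzero: "\<exists>x. prime_trace (x :: 'a::finite_field) \<noteq> 0"
proof (rule ccontr)
  assume *: "\<not> ?thesis"
  define p where "p = CHAR('a)"
  have p: "p > 1" unfolding p_def by (rule prime_gt_1_nat) simp
  obtain n where n: "n > 0" "CARD('a) = p ^ n"
    using ex_CARD_eq_CHAR_power[where 'a = 'a] unfolding p_def by blast
  define F where "F = (\<Sum>i<n. monom 1 (p ^ i) :: 'a poly)"
  have eval: "poly F x = prime_trace x" for x
    using n by (simp add: F_def poly_sum poly_monom prime_trace_eq p_def)
  have "coeff F (p ^ (n - 1)) = (\<Sum>i<n. if i = n - 1 then 1 else 0)"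
    using p by (auto simp: F_def coeff_sum intro!: sum.cong)
  then have F0: "F \<noteq> 0" using n by auto
  have "degree F \<le> p ^ (n - 1)"
    unfolding F_def
  proof (rule degree_sum_le)
    fix i assume "i \<in> {..<n}"
    then show "degree (monom (1 :: 'a) (p ^ i)) \<le> p ^ (n - 1)"
      using p by (intro order.trans[OF degree_monom_le] power_increasing) auto
  qed simp
  moreover have "p ^ (n - 1) < p ^ n" using p n by (intro power_strict_increasing) auto
  moreover have "{x. poly F x = 0} = UNIV" using * eval by auto
  ultimately show False using card_poly_roots_bound[OF F0] n by simp
qed

lemma fq_char_nontrivial: "\<exists>x::'a::finite_field. fq_char x \<noteq> 1"
proof -
  define p where "p = CHAR('a)"
  have p: "p > 0" by (simp add: p_def)
  obtain x :: 'a where x: "prime_trace x \<noteq> 0" using ex_prime_trace_nonzero by blast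
  obtain k where k: "k < p" "of_nat k = prime_trace x"
    using ex_of_nat_prime_trace[of x] unfolding p_def by blast
  have "inj_on (\<lambda>k. cis (2 * pi * real k / real p)) {..<p}"
    using bij_betw_roots_unity[OF p] by (simp add: bij_betw_def)
  then have "fq_char x \<noteq> 1"
    using fq_char_cis[OF k(2)] k x p inj_onD[of "\<lambda>k. cis (2 * pi * real k / real p)" "{..<p}" k 0]
    by (auto simp: p_def)
  then show ?thesis ..
qed

section \<open>A large sieve inequality for characters of a finite abelian group\<close>

lemma character_sum_eq_0:
  fixes \<chi> :: "'v::ab_group_add \<Rightarrow> complex"
  assumes closed: "\<And>x y. x \<in> V \<Longrightarrow> y \<in> V \<Longrightarrow> x - y \<in> V"
    and mult: "\<And>x y. x \<in> V \<Longrightarrow> y \<in> V \<Longrightarrow> \<chi> (x + y) = \<chi> x * \<chi> y"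
    and h: "h \<in> V" "\<chi> h \<noteq> 1"
  shows "(\<Sum>g\<in>V. \<chi> g) = 0"
proof -
  have zero: "0 \<in> V" using closed[OF h(1) h(1)] by simp
  have plus: "x + y \<in> V" if "x \<in> V" "y \<in> V" for x y
    using closed[OF that(1) closed[OF zero that(2)]] by simp
  have "(\<Sum>g\<in>V. \<chi> g) = (\<Sum>g\<in>V. \<chi> (g + h))"
    by (rule sum.reindex_bij_witness[of _ "\<lambda>g. g + h" "\<lambda>g. g - h"]) (use h plus closed in auto)
  also have "\<dots> = \<chi> h * (\<Sum>g\<in>V. \<chi> g)"
    unfolding sum_distrib_left by (intro sum.cong) (simp_all add: mult h mult.commute)
  finally show ?thesis using h by (simp add: mult_cancel_right1)
qed

text \<open>
  Let \<open>S\<^sub>i\<close> be the inner product of \<open>a\<close> with the conjugate of \<open>\<chi>\<^sub>i\<close>, let \<open>T = \<Sum>|S\<^sub>i|\<^sup>2\<close>, and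
  let \<open>P = \<Sum> S\<^sub>i cnj(\<chi>\<^sub>i)\<close>.
  The cross term between \<open>a\<close> and \<open>P\<close> is \<open>T\<close>.  By orthogonality only pairs with equal characters, and hence
  equal \<open>S\<^sub>i\<close>, contribute to \<open>|P|\<^sup>2\<close>, so \<open>|P|\<^sup>2 \<le> M |V| T\<close>.  Expanding \<open>|a - \<kappa> P|\<^sup>2 \<ge> 0\<close> with
  \<open>\<kappa> = 1/(M |V|)\<close> gives the inequality.
\<close>
lemma large_sieve_characters:
  fixes \<chi> :: "'i \<Rightarrow> 'v::ab_group_add \<Rightarrow> complex"
  assumes I: "finite I" and V: "finite V" "0 \<in> V"
    and closed: "\<And>x y. x \<in> V \<Longrightarrow> y \<in> V \<Longrightarrow> x - y \<in> V"
    and mult: "\<And>i x y. i \<in> I \<Longrightarrow> x \<in> V \<Longrightarrow> y \<in> V \<Longrightarrow> \<chi> i (x + y) = \<chi> i x * \<chi> i y"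
    and unit: "\<And>i x. i \<in> I \<Longrightarrow> x \<in> V \<Longrightarrow> cmod (\<chi> i x) = 1"
    and fibre: "\<And>i. i \<in> I \<Longrightarrow> card {j \<in> I. \<forall>g\<in>V. \<chi> j g = \<chi> i g} \<le> M"
  shows "(\<Sum>i\<in>I. (cmod (\<Sum>g\<in>V. a g * \<chi> i g))\<^sup>2) \<le> real M * real (card V) * (\<Sum>g\<in>V. (cmod (a g))\<^sup>2)"
proof (cases "I = {}")
  case False
  define S where "S i = (\<Sum>g\<in>V. a g * \<chi> i g)" for i
  define T where "T = (\<Sum>i\<in>I. (cmod (S i))\<^sup>2)"
  define P where "P g = (\<Sum>i\<in>I. S i * cnj (\<chi> i g))" for g
  define \<kappa> where "\<kappa> = 1 / (real M * real (card V))"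
  have "M > 0"
  proof -
    obtain i where "i \<in> I" using False by blast
    then have "card {j \<in> I. \<forall>g\<in>V. \<chi> j g = \<chi> i g} > 0"
      using I by (subst card_gt_0_iff) auto
    with fibre[OF \<open>i \<in> I\<close>] show ?thesis by linarith
  qed
  moreover have "card V > 0" using V by (auto simp: card_gt_0_iff)
  ultimately have \<kappa>: "\<kappa> > 0" by (simp add: \<kappa>_def)
  have cnj_\<chi>: "cnj (\<chi> i g) * \<chi> i g = 1" if "i \<in> I" "g \<in> V" for i g
    using unit[OF that] complex_norm_square[of "\<chi> i g"] by (simp add: mult.commute)
  have orth: "(\<Sum>g\<in>V. cnj (\<chi> i g) * \<chi> j g) = (if \<forall>g\<in>V. \<chi> j g = \<chi> i g then of_nat (card V) else 0)"
    if ij: "i \<in> I" "j \<in> I" for i j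
  proof (cases "\<forall>g\<in>V. \<chi> j g = \<chi> i g")
    case True
    then show ?thesis using cnj_\<chi>[OF ij(1)] by simp
  next
    case False
    then obtain h where h: "h \<in> V" "\<chi> j h \<noteq> \<chi> i h" by blast
    have "cnj (\<chi> i h) * \<chi> j h \<noteq> 1"
      using cnj_\<chi>[OF ij(1) h(1)] h(2) by (metis mult_cancel_left mult_zero_left zero_neq_one)
    then have "(\<Sum>g\<in>V. cnj (\<chi> i g) * \<chi> j g) = 0"
      using h by (intro character_sum_eq_0[OF closed, where h = h]) (auto simp: mult ij)
    with False show ?thesis by (simp only: if_not_P if_False)
  qed
  have "(\<Sum>g\<in>V. complex_of_real ((cmod (P g))\<^sup>2)) =
      (\<Sum>g\<in>V. \<Sum>i\<in>I. \<Sum>j\<in>I. S i * cnj (S j) * (cnj (\<chi> i g) * \<chi> j g))"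
    unfolding complex_norm_square P_def cnj_sum sum_product by (simp add: mult_ac)
  also have "\<dots> = (\<Sum>i\<in>I. \<Sum>j\<in>I. S i * cnj (S j) * (\<Sum>g\<in>V. cnj (\<chi> i g) * \<chi> j g))"
    by (subst sum.swap, rule sum.cong[OF refl], subst sum.swap) (simp add: sum_distrib_left)
  also have "\<dots> = (\<Sum>i\<in>I. \<Sum>j\<in>I. if \<forall>g\<in>V. \<chi> j g = \<chi> i g then complex_of_real ((cmod (S i))\<^sup>2 * real (card V)) else 0)"
  proof (intro sum.cong refl)
    fix i j assume ij: "i \<in> I" "j \<in> I"
    have "S j = S i" if "\<forall>g\<in>V. \<chi> j g = \<chi> i g" using that by (simp add: S_def)
    with orth[OF ij] show "S i * cnj (S j) * (\<Sum>g\<in>V. cnj (\<chi> i g) * \<chi> j g) =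
       (if \<forall>g\<in>V. \<chi> j g = \<chi> i g then complex_of_real ((cmod (S i))\<^sup>2 * real (card V)) else 0)"
      unfolding of_real_mult complex_norm_square by simp
  qed
  also have "\<dots> = complex_of_real (\<Sum>i\<in>I. \<Sum>j\<in>I. if \<forall>g\<in>V. \<chi> j g = \<chi> i g then (cmod (S i))\<^sup>2 * real (card V) else 0)"
    by (simp only: of_real_sum if_distrib[of complex_of_real] of_real_0)
  finally have "(\<Sum>g\<in>V. (cmod (P g))\<^sup>2) =
      (\<Sum>i\<in>I. \<Sum>j\<in>I. if \<forall>g\<in>V. \<chi> j g = \<chi> i g then (cmod (S i))\<^sup>2 * real (card V) else 0)"
    by (simp only: of_real_sum[symmetric] of_real_eq_iff)
  also have "\<dots> = (\<Sum>i\<in>I. real (card {j \<in> I. \<forall>g\<in>V. \<chi> j g = \<chi> i g}) * ((cmod (S i))\<^sup>2 * real (card V)))"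
    using I by (simp add: sum.If_cases Int_def)
  also have "\<dots> \<le> (\<Sum>i\<in>I. real M * ((cmod (S i))\<^sup>2 * real (card V)))"
    by (intro sum_mono mult_right_mono) (use fibre in auto)
  also have "\<dots> = real M * real (card V) * T"
    by (simp add: T_def sum_distrib_left mult_ac)
  finally have P: "(\<Sum>g\<in>V. (cmod (P g))\<^sup>2) \<le> real M * real (card V) * T" .
  have aP: "(\<Sum>g\<in>V. Re (a g * cnj (P g))) = T"
  proof -
    have "(\<Sum>g\<in>V. a g * cnj (P g)) = (\<Sum>g\<in>V. \<Sum>i\<in>I. cnj (S i) * (a g * \<chi> i g))"
      by (simp add: P_def sum_distrib_left mult_ac)
    also have "\<dots> = (\<Sum>i\<in>I. cnj (S i) * S i)"
      by (subst sum.swap) (simp add: S_def sum_distrib_left)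
    also have "\<dots> = complex_of_real T"
      unfolding T_def of_real_sum complex_norm_square by (simp add: mult.commute)
    finally show ?thesis by (metis Re_sum Re_complex_of_real)
  qed
  have "0 \<le> (\<Sum>g\<in>V. (cmod (a g - of_real \<kappa> * P g))\<^sup>2)" by (simp add: sum_nonneg)
  also have "\<dots> = (\<Sum>g\<in>V. (cmod (a g))\<^sup>2 - 2 * \<kappa> * Re (a g * cnj (P g)) + \<kappa>\<^sup>2 * (cmod (P g))\<^sup>2)"
    by (intro sum.cong refl) (unfold cmod_power2, simp add: power2_eq_square algebra_simps)
  also have "\<dots> = (\<Sum>g\<in>V. (cmod (a g))\<^sup>2) - 2 * \<kappa> * T + \<kappa>\<^sup>2 * (\<Sum>g\<in>V. (cmod (P g))\<^sup>2)"
    by (simp only: sum.distrib sum_subtractf sum_distrib_left[symmetric] aP)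
  also have "\<dots> \<le> (\<Sum>g\<in>V. (cmod (a g))\<^sup>2) - 2 * \<kappa> * T + \<kappa>\<^sup>2 * (real M * real (card V) * T)"
    using P by (simp add: mult_left_mono)
  also have "\<kappa>\<^sup>2 * (real M * real (card V) * T) = \<kappa> * T"
    using \<open>M > 0\<close> \<open>card V > 0\<close> by (simp add: \<kappa>_def power2_eq_square)
  finally have "\<kappa> * T \<le> (\<Sum>g\<in>V. (cmod (a g))\<^sup>2)" by linarith
  then have "T \<le> (\<Sum>g\<in>V. (cmod (a g))\<^sup>2) / \<kappa>"
    using \<kappa> by (simp add: pos_le_divide_eq mult.commute)
  then show ?thesis by (simp add: T_def S_def \<kappa>_def mult.commute)
qed (simp add: sum_nonneg)

section \<open>Arithmetic in quadratic rings\<close>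

definition quad_norm :: "'r::comm_ring_1 \<Rightarrow> 'r \<times> 'r \<Rightarrow> 'r" where
  "quad_norm \<delta> x = (fst x)\<^sup>2 - \<delta> * (snd x)\<^sup>2"

definition quad_conj :: "'r::comm_ring_1 \<times> 'r \<Rightarrow> 'r \<times> 'r" where
  "quad_conj x = (fst x, - snd x)"

text \<open>
  The base ring is displayed instead of the ring itself: the same formulas are used over
  \<open>A\<close> and over its field of fractions.
\<close>
abbreviation quad_mult :: "'r::comm_ring_1 \<times> 'r \<Rightarrow> 'r \<Rightarrow> 'r \<times> 'r \<Rightarrow> 'r \<times> 'r"
    (\<open>(\<open>notation=\<open>mixfix quad_mult\<close>\<close>_ \<odot>\<^bsub>_\<^esub> _)\<close> [70, 0, 71] 70) where
  "x \<odot>\<^bsub>\<delta>\<^esub> y \<equiv> x \<otimes>\<^bsub>quad_ring \<delta>\<^esub> y"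

lemma quad_mult_pair: "(a, b) \<odot>\<^bsub>\<delta>\<^esub> (c, d) = (a * c + \<delta> * b * d, a * d + b * c)"
  by (simp add: quad_ring_def)

lemma quad_ring_simps [simp]:
  "carrier (quad_ring \<delta>) = UNIV" "\<zero>\<^bsub>quad_ring \<delta>\<^esub> = 0" "\<one>\<^bsub>quad_ring \<delta>\<^esub> = (1, 0)"
  "x \<oplus>\<^bsub>quad_ring \<delta>\<^esub> y = x + y"
  by (auto simp: quad_ring_def zero_prod_def split: prod.split)

lemma quad_norm_mult: "quad_norm \<delta> (x \<odot>\<^bsub>\<delta>\<^esub> y) = quad_norm \<delta> x * quad_norm \<delta> y"
  by (cases x; cases y) (simp add: quad_norm_def quad_mult_pair power2_eq_square algebra_simps)

lemma quad_norm_conj [simp]: "quad_norm \<delta> (quad_conj x) = quad_norm \<delta> x"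
  by (simp add: quad_norm_def quad_conj_def)

lemma quad_mult_assoc: "(x \<odot>\<^bsub>\<delta>\<^esub> y) \<odot>\<^bsub>\<delta>\<^esub> z = x \<odot>\<^bsub>\<delta>\<^esub> (y \<odot>\<^bsub>\<delta>\<^esub> z)"
  and quad_mult_commute: "x \<odot>\<^bsub>\<delta>\<^esub> y = y \<odot>\<^bsub>\<delta>\<^esub> x"
  and quad_mult_left_commute: "x \<odot>\<^bsub>\<delta>\<^esub> (y \<odot>\<^bsub>\<delta>\<^esub> z) = y \<odot>\<^bsub>\<delta>\<^esub> (x \<odot>\<^bsub>\<delta>\<^esub> z)"
  by (cases x; cases y; cases z; simp add: quad_mult_pair algebra_simps)+

lemmas quad_mult_ac = quad_mult_assoc quad_mult_commute quad_mult_left_commute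

lemma quad_mult_add_left: "(x + y) \<odot>\<^bsub>\<delta>\<^esub> z = x \<odot>\<^bsub>\<delta>\<^esub> z + y \<odot>\<^bsub>\<delta>\<^esub> z"
  and quad_mult_diff_left: "(x - y) \<odot>\<^bsub>\<delta>\<^esub> z = x \<odot>\<^bsub>\<delta>\<^esub> z - y \<odot>\<^bsub>\<delta>\<^esub> z"
  and quad_mult_diff_right: "z \<odot>\<^bsub>\<delta>\<^esub> (x - y) = z \<odot>\<^bsub>\<delta>\<^esub> x - z \<odot>\<^bsub>\<delta>\<^esub> y"
  by (cases x; cases y; cases z; simp add: quad_mult_pair algebra_simps)+

lemma quad_mult_one_left [simp]: "(1, 0) \<odot>\<^bsub>\<delta>\<^esub> x = x"
  by (cases x) (simp add: quad_mult_pair)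

lemma quad_mult_scale_left: "(c * a, c * b) \<odot>\<^bsub>\<delta>\<^esub> x = (c, 0) \<odot>\<^bsub>\<delta>\<^esub> ((a, b) \<odot>\<^bsub>\<delta>\<^esub> x)"
  by (cases x) (simp add: quad_mult_pair algebra_simps)

lemma quad_conj_mult: "quad_conj (x \<odot>\<^bsub>\<delta>\<^esub> y) = quad_conj x \<odot>\<^bsub>\<delta>\<^esub> quad_conj y"
  by (cases x; cases y) (simp add: quad_mult_pair quad_conj_def)

lemma quad_mult_conj: "x \<odot>\<^bsub>\<delta>\<^esub> quad_conj x = (quad_norm \<delta> x, 0)"
  by (cases x) (simp add: quad_mult_pair quad_conj_def quad_norm_def power2_eq_square algebra_simps)

lemma two_neq_0_poly_fract:
  assumes "odd CARD('a::finite_field)"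
  shows "(2 :: 'a poly fract) \<noteq> 0"
proof -
  obtain n where n: "n > 0" "CARD('a) = CHAR('a) ^ n"
    using ex_CARD_eq_CHAR_power[where 'a = 'a] by blast
  have "(2 :: 'a) \<noteq> 0"
  proof
    assume "(2 :: 'a) = 0"
    then have "of_nat 2 = (0 :: 'a)" by simp
    then have "CHAR('a) dvd 2" by (simp only: of_nat_eq_0_iff_char_dvd)
    then have "CHAR('a) = 2"
      by (rule primes_dvd_imp_eq[OF CHAR_prime two_is_prime_nat])
    with assms n show False by simp
  qed
  then have "(2 :: 'a poly) \<noteq> 0" by (simp add: numeral_poly)
  moreover have "(2 :: 'a poly fract) = to_fract 2"
    by (simp only: one_add_one[symmetric] to_fract_add to_fract_1)
  ultimately show ?thesis by (metis to_fract_eq_0_iff)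
qed

text \<open>
  The inverse of \<open>2\<surd>A (u + v\<surd>A)\<close> is the conjugate \<open>u - v\<surd>A\<close> divided by \<open>2\<surd>A n\<close>, where \<open>n\<close> is the norm.
\<close>
lemma quad_inverse_two_root:
  fixes A n u v :: "'k::Fields.field"
  assumes "(2 :: 'k) \<noteq> 0" "A \<noteq> 0" "n \<noteq> 0" "n = u * u - A * (v * v)"
  shows "((0, 2) \<odot>\<^bsub>A\<^esub> (u, v)) \<odot>\<^bsub>A\<^esub> (- v / (2 * n), u / (2 * A * n)) = (1, 0)"
proof -
  have e1: "A * 2 * v * (- v / (2 * n)) = - (A * (v * v)) / n" using assms(1) by simp
  have e2: "A * (2 * u) * (u / (2 * A * n)) = u * u / n" using assms(1,2) by simp
  have "A * 2 * v * (- v / (2 * n)) + A * (2 * u) * (u / (2 * A * n)) = (u * u - A * (v * v)) / n"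
    unfolding e1 e2 by (simp add: diff_divide_distrib)
  also have "\<dots> = 1" unfolding assms(4)[symmetric] using assms(3) by simp
  finally show ?thesis using assms(1-3) by (simp add: quad_mult_pair)
qed

lemma quad_trace_div_two_root:
  fixes A n u v :: "'k::Fields.field"
  assumes "(2 :: 'k) \<noteq> 0" "A \<noteq> 0"
  shows "quad_trace A ((P, R) \<odot>\<^bsub>A\<^esub> (- v / (2 * n), u / (2 * A * n))) = (R * u - P * v) / n"
proof -
  have e1: "2 * (P * (- v / (2 * n))) = - (P * v) / n" using assms(1) by simp
  have e2: "2 * (A * R * (u / (2 * A * n))) = R * u / n" using assms by simp
  show ?thesis
    unfolding quad_mult_pair quad_trace distrib_left e1 e2 by (simp add: diff_divide_distrib)
qed

text \<open>
  The translation to polynomials: \<open>Tr(x / (2\<surd>\<alpha>))\<close> is the \<open>\<surd>\<alpha>\<close>-coordinate of \<open>x\<close>, and \<open>gr/f\<close> is made to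
  have a polynomial denominator by multiplying with the conjugate of \<open>f\<close>.
\<close>
lemma fract_to_fls_quad_trace:
  fixes \<alpha> :: "'a::finite_field poly"
  assumes two: "(2 :: 'a poly fract) \<noteq> 0" and nz: "\<alpha> \<noteq> 0" "quad_norm \<alpha> f \<noteq> 0"
  shows "fract_to_fls (quad_trace (to_fract \<alpha>)
           (AA_to_KK g \<otimes>\<^bsub>KK \<alpha>\<^esub> AA_to_KK r \<otimes>\<^bsub>KK \<alpha>\<^esub> inv\<^bsub>KK \<alpha>\<^esub> ((0, 2) \<otimes>\<^bsub>KK \<alpha>\<^esub> AA_to_KK f))) =
         poly_to_fls (snd (g \<odot>\<^bsub>\<alpha>\<^esub> r \<odot>\<^bsub>\<alpha>\<^esub> quad_conj f)) / poly_to_fls (quad_norm \<alpha> f)"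
proof -
  obtain f1 f2 where f: "f = (f1, f2)" by (cases f)
  obtain g1 g2 where g: "g = (g1, g2)" by (cases g)
  obtain r1 r2 where r: "r = (r1, r2)" by (cases r)
  interpret cring "KK \<alpha>" unfolding KK_def by (rule cring_quad_ring)
  define n where "n = to_fract (quad_norm \<alpha> f)"
  define A where "A = to_fract \<alpha>"
  have n0: "n \<noteq> 0" and A0: "A \<noteq> 0" using nz by (simp_all add: n_def A_def)
  have n: "n = to_fract f1 * to_fract f1 - A * (to_fract f2 * to_fract f2)"
    by (simp add: n_def A_def f quad_norm_def power2_eq_square)
  have mK: "x \<otimes>\<^bsub>KK \<alpha>\<^esub> y = x \<odot>\<^bsub>A\<^esub> y" for x y by (simp add: KK_def A_def)
  define y where "y = (- to_fract f2 / (2 * n), to_fract f1 / (2 * A * n))"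
  have "((0, 2) \<otimes>\<^bsub>KK \<alpha>\<^esub> AA_to_KK f) \<otimes>\<^bsub>KK \<alpha>\<^esub> y = (1, 0)"
    using quad_inverse_two_root[OF two A0 n0 n] by (simp add: mK y_def f AA_to_KK_def)
  then have "inv\<^bsub>KK \<alpha>\<^esub> ((0, 2) \<otimes>\<^bsub>KK \<alpha>\<^esub> AA_to_KK f) = y"
    by (intro comm_inv_char) (auto simp: KK_def)
  moreover have "quad_trace A (AA_to_KK g \<otimes>\<^bsub>KK \<alpha>\<^esub> AA_to_KK r \<otimes>\<^bsub>KK \<alpha>\<^esub> y)
      = to_fract (snd (g \<odot>\<^bsub>\<alpha>\<^esub> r \<odot>\<^bsub>\<alpha>\<^esub> quad_conj f)) / n"
  proof -
    obtain P R where PR: "g \<odot>\<^bsub>\<alpha>\<^esub> r = (P, R)" by (cases "g \<odot>\<^bsub>\<alpha>\<^esub> r")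
    then have "AA_to_KK g \<odot>\<^bsub>A\<^esub> AA_to_KK r = (to_fract P, to_fract R)"
      by (auto simp: AA_to_KK_def g r quad_mult_pair A_def)
    then show ?thesis
      unfolding mK y_def PR
      by (simp only: quad_trace_div_two_root[OF two A0])
        (simp add: PR quad_mult_pair quad_conj_def f mult.commute)
  qed
  moreover have "to_fract x / n = Fract x (quad_norm \<alpha> f)" for x
    by (simp add: n_def to_fract_def)
  ultimately show ?thesis
    using nz(2) by (simp add: A_def fract_to_fls_Fract)
qed

section \<open>Reduced residue systems\<close>

lemma (in cring) reduced_residue_system_unit:
  assumes f: "f \<in> carrier R" and S: "reduced_residue_system R f S" and r: "r \<in> S"
  obtains s h where "s \<in> carrier R" "h \<in> carrier R" "r \<otimes> s = h \<otimes> f \<oplus> \<one>"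
proof -
  interpret I: ideal "PIdl f" R by (rule cgenideal_ideal[OF f])
  have rR: "r \<in> carrier R" using S r by (auto simp: reduced_residue_system_def)
  have "PIdl f +> r \<in> Units (R Quot (PIdl f))"
    using S r unfolding reduced_residue_system_def by (meson bij_betwE)
  then obtain Y where Y: "Y \<in> carrier (R Quot (PIdl f))"
    "(PIdl f +> r) \<otimes>\<^bsub>R Quot (PIdl f)\<^esub> Y = \<one>\<^bsub>R Quot (PIdl f)\<^esub>"
    unfolding Units_def by blast
  from Y(1) obtain s where s: "s \<in> carrier R" "Y = PIdl f +> s"
    by (auto simp: FactRing_simps)
  have "PIdl f +> (r \<otimes> s) = PIdl f +> \<one>"
    using Y(2) rR s by (simp add: FactRing_def I.rcoset_mult_add)
  moreover have "r \<otimes> s \<in> PIdl f +> (r \<otimes> s)"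
    using rR s by (intro I.a_rcos_self) simp
  ultimately have "r \<otimes> s \<in> PIdl f +> \<one>" by simp
  then obtain h where "h \<in> carrier R" "r \<otimes> s = h \<otimes> f \<oplus> \<one>"
    unfolding a_r_coset_def' cgenideal_def by blast
  with s(1) show thesis by (rule that)
qed

lemma (in cring) reduced_residue_system_inj:
  assumes f: "f \<in> carrier R" and S: "reduced_residue_system R f S" and r: "r \<in> S" "r' \<in> S"
    and h: "h \<in> carrier R" "r = h \<otimes> f \<oplus> r'"
  shows "r = r'"
proof -
  interpret I: ideal "PIdl f" R by (rule cgenideal_ideal[OF f])
  have "r \<in> PIdl f +> r'"
    using h unfolding a_r_coset_def' cgenideal_def by blast
  moreover have "r' \<in> carrier R" using S r(2) by (auto simp: reduced_residue_system_def)
  ultimately have "PIdl f +> r' = PIdl f +> r"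
    by (intro a_repr_independence) (simp_all add: I.a_subgroup)
  then show "r = r'"
    using S r unfolding reduced_residue_system_def by (metis bij_betw_imp_inj_on inj_onD)
qed

section \<open>The coefficient of \<open>1/t\<close> of a rational function\<close>

definition residue_coeff :: "'a::field poly \<Rightarrow> 'a poly \<Rightarrow> 'a" where
  "residue_coeff f n = (poly_to_fls f / poly_to_fls n) $$ 1"

lemma residue_coeff_add: "residue_coeff (f + g) n = residue_coeff f n + residue_coeff g n"
  by (simp add: residue_coeff_def poly_to_fls_add add_divide_distrib)

lemma residue_coeff_diff: "residue_coeff (f - g) n = residue_coeff f n - residue_coeff g n"
  using residue_coeff_add[of "f - g" g n] by simp

lemma residue_coeff_smult: "residue_coeff (smult c f) n = c * residue_coeff f n"
proof -
  have *: "poly_to_fls (smult c f) / poly_to_fls n = fls_const c * (poly_to_fls f / poly_to_fls n)"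
    by (simp add: poly_to_fls_smult)
  show ?thesis unfolding residue_coeff_def * by (simp only: fls_mult_const_nth)
qed

lemma residue_coeff_cancel:
  "m \<noteq> 0 \<Longrightarrow> residue_coeff (f * m) (n * m) = residue_coeff f n"
  by (simp add: residue_coeff_def poly_to_fls_mult)

lemma residue_coeff_multiple: "n \<noteq> 0 \<Longrightarrow> residue_coeff (f * n) n = 0"
  by (simp add: residue_coeff_def poly_to_fls_mult poly_to_fls_nth)

lemma fls_subdegree_poly_to_fls: "f \<noteq> 0 \<Longrightarrow> fls_subdegree (poly_to_fls f) = - int (degree f)"
  by (rule fls_subdegree_eqI) (auto simp: poly_to_fls_nth intro!: coeff_eq_0)

text \<open>
  The fractional part of \<open>R/n\<close> has a leading term \<open>c t^(-i)\<close> with \<open>i = deg n - deg (R mod n)\<close>.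
  If \<open>i \<le> m + 1\<close>, multiplying by \<open>t^(i - 1)\<close> moves it to \<open>t^(-1)\<close>, where it can be seen.  So
  vanishing against all polynomials of degree at most \<open>m\<close> makes the fractional part small.
\<close>
lemma degree_mod_of_residue_coeff_eq_0:
  fixes R n :: "'a::field poly"
  assumes n: "n \<noteq> 0" and vanish: "\<And>f. degree f \<le> m \<Longrightarrow> residue_coeff (f * R) n = 0"
    and nz: "R mod n \<noteq> 0"
  shows "degree (R mod n) + m + 1 < degree n"
proof (rule ccontr)
  assume *: "\<not> ?thesis"
  define R' where "R' = R mod n"
  have R': "R' \<noteq> 0" "degree R' < degree n"
    using nz degree_mod_less'[OF n nz] by (simp_all add: R'_def)
  define j where "j = degree n - degree R' - 1"
  define f where "f = monom (1 :: 'a) j"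
  have f: "f \<noteq> 0" "degree f = j" by (simp_all add: f_def degree_monom_eq)
  have "j \<le> m" using * by (simp add: j_def R'_def)
  have "f * R = (f * (R div n)) * n + f * R'"
    by (simp add: R'_def algebra_simps flip: distrib_left)
  then have "residue_coeff (f * R') n = 0"
    using vanish[of f] f \<open>j \<le> m\<close> n by (simp add: residue_coeff_add residue_coeff_multiple)
  moreover have "fls_subdegree (poly_to_fls (f * R') / poly_to_fls n) = 1"
  proof -
    have "degree (f * R') = degree n - 1"
      using f R' by (simp add: degree_mult_eq j_def)
    then show ?thesis
      using f R' n by (simp add: fls_divide_subdegree fls_subdegree_poly_to_fls)
  qed
  then have "residue_coeff (f * R') n \<noteq> 0"
    using f R' n unfolding residue_coeff_def
    by (metis nth_fls_subdegree_nonzero divide_eq_0_iff poly_to_fls_eq_0_iff mult_eq_0_iff)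
  ultimately show False by simp
qed



text \<open>
  The coefficient of \<open>1/t\<close> of \<open>Tr(g r / (2\<surd>\<alpha> f))\<close>; see \<open>fract_to_fls_quad_trace\<close>.
\<close>
definition pairing_coeff ::
  "'a::field poly \<Rightarrow> 'a poly \<times> 'a poly \<Rightarrow> 'a poly \<times> 'a poly \<Rightarrow> 'a poly \<times> 'a poly \<Rightarrow> 'a" where
  "pairing_coeff \<alpha> f r g = residue_coeff (snd (g \<odot>\<^bsub>\<alpha>\<^esub> r \<odot>\<^bsub>\<alpha>\<^esub> quad_conj f)) (quad_norm \<alpha> f)"

lemma pairing_coeff_add: "pairing_coeff \<alpha> f r (g + h) = pairing_coeff \<alpha> f r g + pairing_coeff \<alpha> f r h"
  by (simp add: pairing_coeff_def quad_mult_add_left residue_coeff_add)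

lemma pairing_coeff_scale:
  "pairing_coeff \<alpha> f r (smult c a, smult c b) = c * pairing_coeff \<alpha> f r (a, b)"
proof -
  have "(smult c a, smult c b) = ([:c:] * a, [:c:] * b)" by simp
  then have "snd ((smult c a, smult c b) \<odot>\<^bsub>\<alpha>\<^esub> r \<odot>\<^bsub>\<alpha>\<^esub> quad_conj f) =
      smult c (snd ((a, b) \<odot>\<^bsub>\<alpha>\<^esub> r \<odot>\<^bsub>\<alpha>\<^esub> quad_conj f))"
    by (simp only: quad_mult_assoc quad_mult_scale_left)
       (cases "(a, b) \<odot>\<^bsub>\<alpha>\<^esub> (r \<odot>\<^bsub>\<alpha>\<^esub> quad_conj f)", simp add: quad_mult_pair)
  then show ?thesis by (simp add: pairing_coeff_def residue_coeff_smult)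
qed

section \<open>Elements of bounded norm\<close>

lemma finite_card_degree_le:
  "finite {f :: 'a::finite_field poly. degree f \<le> k}"
  "card {f :: 'a::finite_field poly. degree f \<le> k} \<le> CARD('a) ^ Suc k"
proof -
  let ?P = "{f :: 'a poly. degree f \<le> k}"
  let ?c = "\<lambda>f :: 'a poly. restrict (coeff f) {..k}"
  let ?F = "{..k} \<rightarrow>\<^sub>E (UNIV :: 'a set)"
  have inj: "inj_on ?c ?P"
  proof (rule inj_onI)
    fix f g :: "'a poly" assume fg: "f \<in> ?P" "g \<in> ?P" "?c f = ?c g"
    show "f = g"
    proof (rule poly_eqI)
      fix i show "coeff f i = coeff g i"
      proof (cases "i \<le> k")
        case True
        then show ?thesis using fun_cong[OF fg(3), of i] by simp
      next
        case False
        then show ?thesis using fg by (simp add: coeff_eq_0)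
      qed
    qed
  qed
  have sub: "?c ` ?P \<subseteq> ?F" by (auto simp: PiE_def extensional_def)
  have fin: "finite ?F" by (intro finite_PiE) auto
  show "finite ?P" by (rule inj_on_finite[OF inj sub fin])
  show "card ?P \<le> CARD('a) ^ Suc k"
    using card_inj_on_le[OF inj sub fin] by (simp add: card_PiE)
qed

context
  fixes \<alpha> :: "'a::finite_field poly"
  assumes nz: "\<alpha> \<noteq> 0" and ram: "odd (degree \<alpha>) \<or> (\<nexists>c. lead_coeff \<alpha> = c\<^sup>2)"
begin

lemma poly_to_fls_quad_norm:
  "poly_to_fls (quad_norm \<alpha> (a, b)) = (poly_to_fls a)\<^sup>2 - poly_to_fls \<alpha> * (poly_to_fls b)\<^sup>2"
proof -
  have diff: "poly_to_fls (f - g) = poly_to_fls f - poly_to_fls g" for f g :: "'a poly"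
    by (rule fls_eqI) (simp add: poly_to_fls_nth)
  show ?thesis by (simp add: quad_norm_def diff poly_to_fls_mult power2_eq_square)
qed

lemma quad_norm_eq_0_iff [simp]: "quad_norm \<alpha> x = 0 \<longleftrightarrow> x = 0"
proof
  assume 0: "quad_norm \<alpha> x = 0"
  obtain a b where x: "x = (a, b)" by (cases x)
  have "max ((kinf_abs (poly_to_fls a))\<^sup>2) (kinf_abs (poly_to_fls \<alpha>) * (kinf_abs (poly_to_fls b))\<^sup>2) = 0"
    using kinf_abs_norm[OF nz ram, of "poly_to_fls a" "poly_to_fls b"] 0
    by (simp flip: poly_to_fls_quad_norm x)
  moreover have "0 \<le> (kinf_abs (poly_to_fls a))\<^sup>2"
    "0 \<le> kinf_abs (poly_to_fls \<alpha>) * (kinf_abs (poly_to_fls b))\<^sup>2" by simp_all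
  ultimately have "(kinf_abs (poly_to_fls a))\<^sup>2 = 0"
    "kinf_abs (poly_to_fls \<alpha>) * (kinf_abs (poly_to_fls b))\<^sup>2 = 0" by linarith+
  then show "x = 0" using nz by (simp add: x zero_prod_def)
qed (simp add: quad_norm_def)

text \<open>
  The leading terms of \<open>a\<^sup>2\<close> and \<open>\<alpha> b\<^sup>2\<close> never cancel: if the degrees agree, \<open>deg \<alpha>\<close> is even, and
  the quotient of the leading coefficients is not a square.  Hence the balls are products of
  spaces of polynomials of bounded degree.
\<close>
lemma degree_quad_norm_le_iff:
  "degree (quad_norm \<alpha> (a, b)) \<le> N \<longleftrightarrow> 2 * degree a \<le> N \<and> (b = 0 \<or> degree \<alpha> + 2 * degree b \<le> N)"
proof (cases "(a, b) = 0")
  case False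
  define q where "q = real CARD('a)"
  have q: "q > 1" unfolding q_def by (rule card_finite_field_gt_1)
  have N0: "quad_norm \<alpha> (a, b) \<noteq> 0" using False by simp
  have pow: "q ^ i \<le> q ^ j \<longleftrightarrow> i \<le> j" for i j using q by simp
  have abs_a: "(kinf_abs (poly_to_fls a))\<^sup>2 = (if a = 0 then 0 else q ^ (2 * degree a))"
    by (simp add: kinf_abs_poly q_def power_mult[symmetric] mult.commute)
  have abs_b: "kinf_abs (poly_to_fls \<alpha>) * (kinf_abs (poly_to_fls b))\<^sup>2 =
      (if b = 0 then 0 else q ^ (degree \<alpha> + 2 * degree b))"
    using nz by (simp add: kinf_abs_poly q_def power_add power_mult[symmetric] mult.commute)
  have "degree (quad_norm \<alpha> (a, b)) \<le> N \<longleftrightarrow> kinf_abs (poly_to_fls (quad_norm \<alpha> (a, b))) \<le> q ^ N"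
    using N0 by (simp add: kinf_abs_poly pow flip: q_def)
  also have "\<dots> \<longleftrightarrow> (kinf_abs (poly_to_fls a))\<^sup>2 \<le> q ^ N \<and>
      kinf_abs (poly_to_fls \<alpha>) * (kinf_abs (poly_to_fls b))\<^sup>2 \<le> q ^ N"
    unfolding poly_to_fls_quad_norm kinf_abs_norm[OF nz ram] by simp
  also have "\<dots> \<longleftrightarrow> 2 * degree a \<le> N \<and> (b = 0 \<or> degree \<alpha> + 2 * degree b \<le> N)"
    unfolding abs_a abs_b using q by (auto simp: pow)
  finally show ?thesis .
qed (simp add: quad_norm_def zero_prod_def)

lemma NN_eq_iff:
  assumes "f \<noteq> 0"
  shows "NN \<alpha> (AA_to_KKinf f) = real CARD('a) ^ Q \<longleftrightarrow> degree (quad_norm \<alpha> f) = Q"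
proof -
  obtain a b where f: "f = (a, b)" by (cases f)
  show ?thesis
    using NN_AA_to_KKinf[OF nz ram, of a b] assms card_finite_field_gt_1[where 'a = 'a]
    by (simp add: f zero_prod_def quad_norm_def mult.commute)
qed

lemma AA_to_KKinf_in_BB_iff:
  "AA_to_KKinf g \<in> BB \<alpha> \<zero>\<^bsub>KKinf \<alpha>\<^esub> (real N) \<longleftrightarrow> degree (quad_norm \<alpha> g) \<le> N"
proof -
  interpret R: cring "KKinf \<alpha>" unfolding KKinf_def by (rule cring_quad_ring)
  obtain a b where g: "g = (a, b)" by (cases g)
  have UN: "carrier (KKinf \<alpha>) = UNIV" by (simp add: KKinf_def)
  have minus: "x \<ominus>\<^bsub>KKinf \<alpha>\<^esub> \<zero>\<^bsub>KKinf \<alpha>\<^esub> = x" for x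
    by (simp add: a_minus_def UN)
  have q: "1 < real CARD('a)" by (rule card_finite_field_gt_1)
  have "NN \<alpha> (AA_to_KKinf g) \<le> real CARD('a) powr real N \<longleftrightarrow> degree (quad_norm \<alpha> g) \<le> N"
  proof (cases "g = 0")
    case True
    then show ?thesis
      by (simp add: NN_def AA_to_KKinf_def KKinf_abs[OF nz ram] zero_prod_def quad_norm_def)
  next
    case False
    then show ?thesis
      using NN_AA_to_KKinf[OF nz ram, of a b] q
      by (simp add: g zero_prod_def quad_norm_def mult.commute powr_realpow)
  qed
  then show ?thesis by (simp add: BB_def UN minus)
qed

text \<open>
  Both coordinates have degree at most \<open>N/2\<close>.  For \<open>N = 0\<close> the bound also limits the number of units.
\<close>
lemma finite_norm_ball: "finite {g. degree (quad_norm \<alpha> g) \<le> N}"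
  and card_norm_ball_le: "card {g. degree (quad_norm \<alpha> g) \<le> N} \<le> CARD('a) ^ (N + 2)"
proof -
  let ?D = "{f :: 'a poly. degree f \<le> N div 2}"
  have sub: "{g. degree (quad_norm \<alpha> g) \<le> N} \<subseteq> ?D \<times> ?D"
    by (auto simp: degree_quad_norm_le_iff)
  have fin: "finite (?D \<times> ?D)" by (simp add: finite_card_degree_le)
  show "finite {g. degree (quad_norm \<alpha> g) \<le> N}" by (rule finite_subset[OF sub fin])
  have "card {g. degree (quad_norm \<alpha> g) \<le> N} \<le> card ?D * card ?D"
    using card_mono[OF fin sub] by (simp add: card_cartesian_product)
  also have "\<dots> \<le> CARD('a) ^ Suc (N div 2) * CARD('a) ^ Suc (N div 2)"
    by (intro mult_mono finite_card_degree_le) auto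
  also have "\<dots> = CARD('a) ^ (Suc (N div 2) + Suc (N div 2))"
    by (simp only: power_add)
  also have "\<dots> \<le> CARD('a) ^ (N + 2)"
    by (intro power_increasing) auto
  finally show "card {g. degree (quad_norm \<alpha> g) \<le> N} \<le> CARD('a) ^ (N + 2)" .
qed

lemma norm_ball_diff:
  "degree (quad_norm \<alpha> g) \<le> N \<Longrightarrow> degree (quad_norm \<alpha> h) \<le> N \<Longrightarrow> degree (quad_norm \<alpha> (g - h)) \<le> N"
proof (cases g; cases h)
  fix a b c d assume gh: "degree (quad_norm \<alpha> g) \<le> N" "degree (quad_norm \<alpha> h) \<le> N"
    and [simp]: "g = (a, b)" "h = (c, d)"
  have "degree (a - c) \<le> N div 2"
    using gh by (intro degree_diff_le) (auto simp: degree_quad_norm_le_iff)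
  then have "2 * degree (a - c) \<le> N" by linarith
  moreover have "b - d = 0 \<or> degree \<alpha> + 2 * degree (b - d) \<le> N"
  proof (cases "degree \<alpha> \<le> N")
    case True
    then have "degree b \<le> (N - degree \<alpha>) div 2" "degree d \<le> (N - degree \<alpha>) div 2"
      using gh by (auto simp: degree_quad_norm_le_iff)
    then have "degree (b - d) \<le> (N - degree \<alpha>) div 2" by (rule degree_diff_le)
    then show ?thesis using True by linarith
  next
    case False
    then show ?thesis using gh by (auto simp: degree_quad_norm_le_iff)
  qed
  ultimately show ?thesis by (simp add: degree_quad_norm_le_iff)
qed

text \<open>
  Stability under constants is what allows passing from the \<open>p\<close>-th roots of unity given by
  \<^const>\<open>fq_char\<close> back to values in the field.
\<close>
lemma norm_ball_scale:
  "degree (quad_norm \<alpha> (a, b)) \<le> N \<Longrightarrow> degree (quad_norm \<alpha> (smult c a, smult c b)) \<le> N"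
  using degree_smult_le[of c a] degree_smult_le[of c b]
  by (auto simp: degree_quad_norm_le_iff)



lemma quad_mult_eq_0_iff: "x \<odot>\<^bsub>\<alpha>\<^esub> y = 0 \<longleftrightarrow> x = 0 \<or> y = 0"
  unfolding quad_norm_eq_0_iff[symmetric] quad_norm_mult by simp

lemma quad_mult_right_cancel: "z \<noteq> 0 \<Longrightarrow> x \<odot>\<^bsub>\<alpha>\<^esub> z = y \<odot>\<^bsub>\<alpha>\<^esub> z \<Longrightarrow> x = y"
  using quad_mult_eq_0_iff[of "x - y" z] by (simp add: quad_mult_diff_left)

section \<open>Spacing of the fractions modulo the order\<close>

text \<open>
  Let \<open>n\<close> be the norm of \<open>F\<close> and \<open>z / F = (P + R\<surd>\<alpha>) / n\<close>.  Testing against \<open>g = a\<close> and \<open>g = b\<surd>\<alpha>\<close> bounds the degrees of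
  the remainders of \<open>R\<close> and \<open>P\<close> modulo \<open>n\<close>.  These remainders are the coordinates of \<open>w = (z - hF) cnj(F)\<close>
  for the quotient \<open>h\<close>.  If \<open>z \<noteq> hF\<close>, the norm of \<open>w\<close> is a nonzero multiple of \<open>n\<close>, but the bounds make its
  degree smaller than that of \<open>n\<close>.
\<close>
lemma dvd_of_residue_coeff_eq_0:
  assumes F: "F \<noteq> 0" "degree (quad_norm \<alpha> F) + degree \<alpha> \<le> N"
    and vanish: "\<And>g. degree (quad_norm \<alpha> g) \<le> N \<Longrightarrow>
      residue_coeff (snd (g \<odot>\<^bsub>\<alpha>\<^esub> (z \<odot>\<^bsub>\<alpha>\<^esub> quad_conj F))) (quad_norm \<alpha> F) = 0"
  obtains h where "z = h \<odot>\<^bsub>\<alpha>\<^esub> F"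
proof -
  define n where "n = quad_norm \<alpha> F"
  have n0: "n \<noteq> 0" using F by (simp add: n_def)
  obtain P R where PR: "z \<odot>\<^bsub>\<alpha>\<^esub> quad_conj F = (P, R)" by (cases "z \<odot>\<^bsub>\<alpha>\<^esub> quad_conj F")
  have R: "degree (R mod n) + N div 2 + 1 < degree n" if "R mod n \<noteq> 0"
  proof (rule degree_mod_of_residue_coeff_eq_0[OF n0 _ that])
    fix f :: "'a poly" assume "degree f \<le> N div 2"
    then show "residue_coeff (f * R) n = 0"
      using vanish[of "(f, 0)"] by (simp add: PR quad_mult_pair n_def degree_quad_norm_le_iff)
  qed
  have P: "degree (P mod n) + (N - degree \<alpha>) div 2 + 1 < degree n" if "P mod n \<noteq> 0"
  proof (rule degree_mod_of_residue_coeff_eq_0[OF n0 _ that])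
    fix f :: "'a poly" assume "degree f \<le> (N - degree \<alpha>) div 2"
    then have "degree \<alpha> + 2 * degree f \<le> N" using F(2) by linarith
    then show "residue_coeff (f * P) n = 0"
      using vanish[of "(0, f)"] by (simp add: PR quad_mult_pair n_def degree_quad_norm_le_iff)
  qed
  define w where "w = (P mod n, R mod n)"
  define h where "h = (P div n, R div n)"
  have w: "w = (z - h \<odot>\<^bsub>\<alpha>\<^esub> F) \<odot>\<^bsub>\<alpha>\<^esub> quad_conj F"
  proof -
    have "(h \<odot>\<^bsub>\<alpha>\<^esub> F) \<odot>\<^bsub>\<alpha>\<^esub> quad_conj F = (P div n * n, R div n * n)"
      by (cases F) (simp add: h_def n_def quad_norm_def quad_conj_def quad_mult_pair power2_eq_square algebra_simps)
    moreover have "(x - y) \<odot>\<^bsub>\<alpha>\<^esub> v = x \<odot>\<^bsub>\<alpha>\<^esub> v - y \<odot>\<^bsub>\<alpha>\<^esub> v" for x y v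
      by (cases x; cases y; cases v) (simp add: quad_mult_pair algebra_simps)
    ultimately show ?thesis
      by (simp add: PR w_def minus_div_mult_eq_mod)
  qed
  have "z - h \<odot>\<^bsub>\<alpha>\<^esub> F = 0"
  proof (rule ccontr)
    assume nonzero: "z - h \<odot>\<^bsub>\<alpha>\<^esub> F \<noteq> 0"
    have norm_w: "quad_norm \<alpha> w = quad_norm \<alpha> (z - h \<odot>\<^bsub>\<alpha>\<^esub> F) * n"
      by (simp add: w quad_norm_mult n_def)
    then have deg: "degree n \<le> degree (quad_norm \<alpha> w)"
      using nonzero n0 by (simp add: degree_mult_eq)
    have "quad_norm \<alpha> w \<noteq> 0" using norm_w nonzero n0 by simp
    then have "w \<noteq> 0" by simp
    then have "degree n > 0" using P R by (auto simp: w_def zero_prod_def)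
    have "2 * degree (P mod n) \<le> degree n - 1"
    proof (cases "P mod n = 0")
      case False
      then show ?thesis using P F(2) unfolding n_def[symmetric] by linarith
    qed simp
    moreover have "R mod n = 0 \<or> degree \<alpha> + 2 * degree (R mod n) \<le> degree n - 1"
      using R F(2) unfolding n_def[symmetric] by linarith
    ultimately have "degree (quad_norm \<alpha> w) \<le> degree n - 1"
      by (simp add: w_def degree_quad_norm_le_iff)
    with deg \<open>degree n > 0\<close> show False by linarith
  qed
  then show thesis using that by simp
qed

text \<open>
  The fractions \<open>r/f\<close> and \<open>r'/f'\<close> are brought to the common denominator \<open>ff'\<close>.
\<close>
lemma pairing_coeff_diff:
  assumes "f \<noteq> 0" "f' \<noteq> 0"
  shows "pairing_coeff \<alpha> f r g - pairing_coeff \<alpha> f' r' g =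
    pairing_coeff \<alpha> (f \<odot>\<^bsub>\<alpha>\<^esub> f') (r \<odot>\<^bsub>\<alpha>\<^esub> f' - r' \<odot>\<^bsub>\<alpha>\<^esub> f) g"
proof -
  have *: "pairing_coeff \<alpha> f r g = pairing_coeff \<alpha> (f \<odot>\<^bsub>\<alpha>\<^esub> f') (r \<odot>\<^bsub>\<alpha>\<^esub> f') g"
    if "f \<noteq> 0" "f' \<noteq> 0" for f f' r
  proof -
    have "g \<odot>\<^bsub>\<alpha>\<^esub> (r \<odot>\<^bsub>\<alpha>\<^esub> f') \<odot>\<^bsub>\<alpha>\<^esub> quad_conj (f \<odot>\<^bsub>\<alpha>\<^esub> f') =
        (g \<odot>\<^bsub>\<alpha>\<^esub> r \<odot>\<^bsub>\<alpha>\<^esub> quad_conj f) \<odot>\<^bsub>\<alpha>\<^esub> (quad_norm \<alpha> f', 0)"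
      unfolding quad_conj_mult quad_mult_conj[symmetric] by (simp only: quad_mult_ac)
    then have "snd (g \<odot>\<^bsub>\<alpha>\<^esub> (r \<odot>\<^bsub>\<alpha>\<^esub> f') \<odot>\<^bsub>\<alpha>\<^esub> quad_conj (f \<odot>\<^bsub>\<alpha>\<^esub> f')) =
        snd (g \<odot>\<^bsub>\<alpha>\<^esub> r \<odot>\<^bsub>\<alpha>\<^esub> quad_conj f) * quad_norm \<alpha> f'"
      by (cases "g \<odot>\<^bsub>\<alpha>\<^esub> r \<odot>\<^bsub>\<alpha>\<^esub> quad_conj f") (simp add: quad_mult_pair)
    then show ?thesis
      using that by (simp add: pairing_coeff_def quad_norm_mult residue_coeff_cancel quad_norm_eq_0_iff)
  qed
  show ?thesis
    unfolding *[OF assms, of r] *[OF assms(2,1), of r'] quad_mult_commute[of \<alpha> f' f]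
    unfolding pairing_coeff_def residue_coeff_diff[symmetric]
    by (simp add: quad_mult_diff_left quad_mult_diff_right)
qed

text \<open>
  If the values differed at \<open>g\<close>, some multiple \<open>cg\<close> would have values differing by an \<open>x\<close> with
  \<open>fq_char x \<noteq> 1\<close>.
\<close>
lemma pairing_coeff_eq_if_chars_eq:
  assumes eq: "\<And>g. degree (quad_norm \<alpha> g) \<le> N \<Longrightarrow>
      fq_char (pairing_coeff \<alpha> f r g) = fq_char (pairing_coeff \<alpha> f' r' g)"
    and g: "degree (quad_norm \<alpha> g) \<le> N"
  shows "pairing_coeff \<alpha> f r g = pairing_coeff \<alpha> f' r' g"
proof (rule ccontr)
  define D where "D = pairing_coeff \<alpha> f r g - pairing_coeff \<alpha> f' r' g"
  assume "\<not> ?thesis"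
  then have D: "D \<noteq> 0" by (simp add: D_def)
  obtain x :: 'a where x: "fq_char x \<noteq> 1" using fq_char_nontrivial by blast
  obtain a b where ab: "g = (a, b)" by (cases g)
  define c where "c = x / D"
  have "x + c * pairing_coeff \<alpha> f' r' g = c * pairing_coeff \<alpha> f r g"
    using D by (simp add: c_def D_def field_simps)
  then have "fq_char x * fq_char (c * pairing_coeff \<alpha> f' r' g) = fq_char (c * pairing_coeff \<alpha> f r g)"
    by (simp flip: fq_char_add)
  also have "\<dots> = fq_char (c * pairing_coeff \<alpha> f' r' g)"
    using eq[of "(smult c a, smult c b)"] norm_ball_scale[of a b N c] g
    by (simp add: pairing_coeff_scale ab)
  finally show False
    using x norm_fq_char[of "c * pairing_coeff \<alpha> f' r' g"] by auto
qed

text \<open>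
  The conclusion says that \<open>r/f\<close> and \<open>r'/f'\<close> are congruent modulo the order.  The ball is large enough
  because \<open>ff'\<close> has norm \<open>q^(2Q)\<close>.
\<close>
lemma fractions_congruent_of_chars_eq:
  assumes f: "f \<noteq> 0" "degree (quad_norm \<alpha> f) = Q" and f': "f' \<noteq> 0" "degree (quad_norm \<alpha> f') = Q"
    and N: "2 * Q + degree \<alpha> \<le> N"
    and eq: "\<And>g. degree (quad_norm \<alpha> g) \<le> N \<Longrightarrow>
      fq_char (pairing_coeff \<alpha> f r g) = fq_char (pairing_coeff \<alpha> f' r' g)"
  obtains h where "r \<odot>\<^bsub>\<alpha>\<^esub> f' - r' \<odot>\<^bsub>\<alpha>\<^esub> f = h \<odot>\<^bsub>\<alpha>\<^esub> (f \<odot>\<^bsub>\<alpha>\<^esub> f')"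
proof (rule dvd_of_residue_coeff_eq_0)
  show "f \<odot>\<^bsub>\<alpha>\<^esub> f' \<noteq> 0" using f f' by (simp add: quad_mult_eq_0_iff)
  show "degree (quad_norm \<alpha> (f \<odot>\<^bsub>\<alpha>\<^esub> f')) + degree \<alpha> \<le> N"
    using f f' N by (simp add: quad_norm_mult degree_mult_eq quad_norm_eq_0_iff)
  fix g assume "degree (quad_norm \<alpha> g) \<le> N"
  then have "pairing_coeff \<alpha> f r g - pairing_coeff \<alpha> f' r' g = 0"
    using pairing_coeff_eq_if_chars_eq[OF eq] by simp
  then show "residue_coeff (snd (g \<odot>\<^bsub>\<alpha>\<^esub> ((r \<odot>\<^bsub>\<alpha>\<^esub> f' - r' \<odot>\<^bsub>\<alpha>\<^esub> f) \<odot>\<^bsub>\<alpha>\<^esub> quad_conj (f \<odot>\<^bsub>\<alpha>\<^esub> f'))))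
      (quad_norm \<alpha> (f \<odot>\<^bsub>\<alpha>\<^esub> f')) = 0"
    unfolding pairing_coeff_diff[OF f(1) f'(1)] by (simp add: pairing_coeff_def quad_mult_assoc)
qed

lemma AA_cring: "cring (AA \<alpha>)"
  unfolding AA_def by (rule cring_quad_ring)

lemma numerator_unique_of_chars_eq:
  assumes f: "f \<noteq> 0" "degree (quad_norm \<alpha> f) = Q" and N: "2 * Q + degree \<alpha> \<le> N"
    and S: "reduced_residue_system (AA \<alpha>) f S" and r: "r \<in> S" "r' \<in> S"
    and eq: "\<And>g. degree (quad_norm \<alpha> g) \<le> N \<Longrightarrow>
      fq_char (pairing_coeff \<alpha> f r g) = fq_char (pairing_coeff \<alpha> f r' g)"
  shows "r = r'"
proof -
  obtain h where "r \<odot>\<^bsub>\<alpha>\<^esub> f - r' \<odot>\<^bsub>\<alpha>\<^esub> f = h \<odot>\<^bsub>\<alpha>\<^esub> (f \<odot>\<^bsub>\<alpha>\<^esub> f)"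
    using fractions_congruent_of_chars_eq[OF f f N eq] by blast
  then have "(r - r') \<odot>\<^bsub>\<alpha>\<^esub> f = (h \<odot>\<^bsub>\<alpha>\<^esub> f) \<odot>\<^bsub>\<alpha>\<^esub> f"
    by (simp add: quad_mult_diff_left quad_mult_assoc)
  then have "r - r' = h \<odot>\<^bsub>\<alpha>\<^esub> f" by (rule quad_mult_right_cancel[OF f(1)])
  then have "r = h \<odot>\<^bsub>\<alpha>\<^esub> f + r'" by (simp add: algebra_simps)
  then show ?thesis
    using cring.reduced_residue_system_inj[OF AA_cring _ S r, of h] by (simp add: AA_def)
qed

text \<open>
  Incongruent numerators give different functionals on a fixed finite ball, and there are only
  finitely many of those.
\<close>
lemma finite_reduced_residue_system:
  assumes f: "f \<noteq> 0" and S: "reduced_residue_system (AA \<alpha>) f S"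
  shows "finite S"
proof -
  \<comment> \<open>Large enough for the functionals on the ball to separate the residue classes modulo \<open>f\<close>.\<close>
  define N where "N = 2 * degree (quad_norm \<alpha> f) + degree \<alpha>"
  define V where "V = {g. degree (quad_norm \<alpha> g) \<le> N}"
  have "inj_on (\<lambda>r. restrict (pairing_coeff \<alpha> f r) V) S"
  proof (rule inj_onI)
    fix r r' assume r: "r \<in> S" "r' \<in> S"
      and eq: "restrict (pairing_coeff \<alpha> f r) V = restrict (pairing_coeff \<alpha> f r') V"
    have "pairing_coeff \<alpha> f r g = pairing_coeff \<alpha> f r' g" if "degree (quad_norm \<alpha> g) \<le> N" for g
      using fun_cong[OF eq, of g] that by (simp add: V_def)
    then show "r = r'"
      using numerator_unique_of_chars_eq[OF f refl _ S r, of N] by (simp add: N_def)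
  qed
  moreover have "(\<lambda>r. restrict (pairing_coeff \<alpha> f r) V) ` S \<subseteq> V \<rightarrow>\<^sub>E UNIV"
    by (auto simp: PiE_def extensional_def)
  moreover have "finite (V \<rightarrow>\<^sub>E (UNIV :: 'a set))"
    unfolding V_def by (intro finite_PiE finite_norm_ball) auto
  ultimately show ?thesis by (rule inj_on_finite)
qed

text \<open>
  From \<open>r f' - r' f = h f f'\<close> one sees that \<open>f\<close> divides \<open>r f'\<close>; since \<open>r\<close> is a unit modulo \<open>f\<close>, it divides
  \<open>f'\<close>, and equality of norms gives the quotient norm 1.
\<close>
lemma associated_of_chars_eq:
  assumes f: "f \<noteq> 0" "degree (quad_norm \<alpha> f) = Q" and f': "f' \<noteq> 0" "degree (quad_norm \<alpha> f') = Q"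
    and N: "2 * Q + degree \<alpha> \<le> N"
    and S: "reduced_residue_system (AA \<alpha>) f S" "r \<in> S"
    and eq: "\<And>g. degree (quad_norm \<alpha> g) \<le> N \<Longrightarrow>
      fq_char (pairing_coeff \<alpha> f r g) = fq_char (pairing_coeff \<alpha> f' r' g)"
  obtains u where "f' = u \<odot>\<^bsub>\<alpha>\<^esub> f" "degree (quad_norm \<alpha> u) = 0"
proof -
  obtain h where h: "r \<odot>\<^bsub>\<alpha>\<^esub> f' - r' \<odot>\<^bsub>\<alpha>\<^esub> f = h \<odot>\<^bsub>\<alpha>\<^esub> (f \<odot>\<^bsub>\<alpha>\<^esub> f')"
    using fractions_congruent_of_chars_eq[OF f f' N eq] by blast
  then have rf': "r \<odot>\<^bsub>\<alpha>\<^esub> f' = h \<odot>\<^bsub>\<alpha>\<^esub> (f \<odot>\<^bsub>\<alpha>\<^esub> f') + r' \<odot>\<^bsub>\<alpha>\<^esub> f"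
    by (simp add: diff_eq_eq)
  have "f \<in> carrier (AA \<alpha>)" by (simp add: AA_def)
  then obtain s k where "r \<otimes>\<^bsub>AA \<alpha>\<^esub> s = k \<otimes>\<^bsub>AA \<alpha>\<^esub> f \<oplus>\<^bsub>AA \<alpha>\<^esub> \<one>\<^bsub>AA \<alpha>\<^esub>"
    using cring.reduced_residue_system_unit[OF AA_cring _ S] by blast
  then have rs: "r \<odot>\<^bsub>\<alpha>\<^esub> s = k \<odot>\<^bsub>\<alpha>\<^esub> f + (1, 0)" by (simp add: AA_def)
  define u where "u = s \<odot>\<^bsub>\<alpha>\<^esub> (h \<odot>\<^bsub>\<alpha>\<^esub> f') + s \<odot>\<^bsub>\<alpha>\<^esub> r' - k \<odot>\<^bsub>\<alpha>\<^esub> f'"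
  have "k \<odot>\<^bsub>\<alpha>\<^esub> f \<odot>\<^bsub>\<alpha>\<^esub> f' + f' = (r \<odot>\<^bsub>\<alpha>\<^esub> s) \<odot>\<^bsub>\<alpha>\<^esub> f'"
    by (simp add: rs quad_mult_add_left)
  also have "\<dots> = (r \<odot>\<^bsub>\<alpha>\<^esub> f') \<odot>\<^bsub>\<alpha>\<^esub> s"
    by (simp only: quad_mult_ac)
  also have "\<dots> = (s \<odot>\<^bsub>\<alpha>\<^esub> (h \<odot>\<^bsub>\<alpha>\<^esub> f') + s \<odot>\<^bsub>\<alpha>\<^esub> r') \<odot>\<^bsub>\<alpha>\<^esub> f"
    unfolding rf' quad_mult_add_left by (simp only: quad_mult_ac)
  also have "\<dots> = u \<odot>\<^bsub>\<alpha>\<^esub> f + k \<odot>\<^bsub>\<alpha>\<^esub> f \<odot>\<^bsub>\<alpha>\<^esub> f'"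
    by (simp add: u_def quad_mult_diff_left) (simp only: quad_mult_ac)
  finally have u: "f' = u \<odot>\<^bsub>\<alpha>\<^esub> f" by (simp add: add.commute)
  then have "u \<noteq> 0" using f'(1) quad_mult_eq_0_iff by blast
  then have "degree (quad_norm \<alpha> u) + Q = Q"
    using f f' u by (metis degree_mult_eq quad_norm_eq_0_iff quad_norm_mult)
  with u show thesis by (intro that[of u]) simp_all
qed

text \<open>
  The denominators \<open>f'\<close> that occur are unit multiples of \<open>f\<close>, and each of them occurs with one
  numerator only.
\<close>
lemma card_equal_chars_le:
  assumes R: "\<And>f. f \<noteq> 0 \<Longrightarrow> reduced_residue_system (AA \<alpha>) f (R f)"
    and N: "2 * Q + degree \<alpha> \<le> N"
    and f: "f \<noteq> 0" "degree (quad_norm \<alpha> f) = Q" and r: "r \<in> R f"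
  shows "card {(f', r') \<in> (SIGMA f:{f. f \<noteq> 0 \<and> degree (quad_norm \<alpha> f) = Q}. R f).
      \<forall>g\<in>{g. degree (quad_norm \<alpha> g) \<le> N}.
        fq_char (pairing_coeff \<alpha> f' r' g) = fq_char (pairing_coeff \<alpha> f r g)} \<le> CARD('a) ^ 2"
    (is "card ?T \<le> _")
proof -
  let ?U = "{u. degree (quad_norm \<alpha> u) \<le> 0}"
  have inj: "inj_on fst ?T"
  proof (rule inj_onI)
    fix x y assume xy: "x \<in> ?T" "y \<in> ?T" "fst x = fst y"
    then obtain f' r1 r2 where *: "x = (f', r1)" "y = (f', r2)" by (cases x; cases y) auto
    have "r1 = r2"
      by (rule numerator_unique_of_chars_eq[OF _ _ N R, of f']) (use xy * in auto)
    with * show "x = y" by simp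
  qed
  have sub: "fst ` ?T \<subseteq> (\<lambda>u. u \<odot>\<^bsub>\<alpha>\<^esub> f) ` ?U"
  proof
    fix f' assume "f' \<in> fst ` ?T"
    then obtain r' where "(f', r') \<in> ?T" by auto
    then have T: "f' \<noteq> 0" "degree (quad_norm \<alpha> f') = Q"
      "\<And>g. degree (quad_norm \<alpha> g) \<le> N \<Longrightarrow>
        fq_char (pairing_coeff \<alpha> f r g) = fq_char (pairing_coeff \<alpha> f' r' g)"
      by auto
    obtain u where "f' = u \<odot>\<^bsub>\<alpha>\<^esub> f" "degree (quad_norm \<alpha> u) = 0"
      by (rule associated_of_chars_eq[OF f T(1,2) N R[OF f(1)] r T(3)])
    then show "f' \<in> (\<lambda>u. u \<odot>\<^bsub>\<alpha>\<^esub> f) ` ?U" by simp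
  qed
  have fin: "finite ?U" by (rule finite_norm_ball)
  have "card ?T = card (fst ` ?T)" by (rule card_image[OF inj, symmetric])
  also have "\<dots> \<le> card ((\<lambda>u. u \<odot>\<^bsub>\<alpha>\<^esub> f) ` ?U)" by (rule card_mono[OF finite_imageI[OF fin] sub])
  also have "\<dots> \<le> card ?U" by (rule card_image_le[OF fin])
  also have "\<dots> \<le> CARD('a) ^ 2" using card_norm_ball_le[of 0] by (simp add: numeral_2_eq_2)
  finally show ?thesis .
qed

section \<open>The large sieve inequality for the order\<close>

text \<open>
  The factor \<open>q^(deg \<alpha> + 4)\<close> collects \<open>q\<^sup>2\<close> for the multiplicity, \<open>q\<^sup>2\<close> for the size of the ball, and
  \<open>q^(deg \<alpha>)\<close> for enlarging the ball.
\<close>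
lemma large_sieve_quadratic:
  assumes R: "\<And>f. f \<noteq> 0 \<Longrightarrow> reduced_residue_system (AA \<alpha>) f (R f)"
  shows "(\<Sum>f | f \<noteq> 0 \<and> degree (quad_norm \<alpha> f) = Q. \<Sum>r\<in>R f.
      (cmod (\<Sum>g | degree (quad_norm \<alpha> g) \<le> N. a g * fq_char (pairing_coeff \<alpha> f r g)))\<^sup>2)
    \<le> real CARD('a) ^ (degree \<alpha> + 4) * (real CARD('a) ^ (2 * Q) + real CARD('a) ^ N) *
      (\<Sum>g | degree (quad_norm \<alpha> g) \<le> N. (cmod (a g))\<^sup>2)"
proof -
  define q where "q = real CARD('a)"
  have q: "q > 1" unfolding q_def by (rule card_finite_field_gt_1)
  \<comment> \<open>Large enough to contain the support of \<open>a\<close> and for equal characters to force equal fractions.\<close>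
  define N' where "N' = max N (2 * Q + degree \<alpha>)"
  define V where "V = {g. degree (quad_norm \<alpha> g) \<le> N}"
  define V' where "V' = {g. degree (quad_norm \<alpha> g) \<le> N'}"
  define F where "F = {f. f \<noteq> 0 \<and> degree (quad_norm \<alpha> f) = Q}"
  define \<chi> where "\<chi> = (\<lambda>(f, r) g. fq_char (pairing_coeff \<alpha> f r g))"
  define b where "b g = (if g \<in> V then a g else 0)" for g
  have finV': "finite V'" unfolding V'_def by (rule finite_norm_ball)
  have VV': "V \<subseteq> V'" by (auto simp: V_def V'_def N'_def)
  have finF: "finite F"
    by (rule finite_subset[OF _ finite_norm_ball[of Q]]) (auto simp: F_def)
  have finR: "finite (R f)" if "f \<in> F" for f
    using that R[of f] finite_reduced_residue_system[of f "R f"] by (auto simp: F_def)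
  have extend: "(\<Sum>g\<in>V. a g * c g) = (\<Sum>g\<in>V'. b g * c g)" for c :: "_ \<Rightarrow> complex"
    by (rule sum.mono_neutral_cong_left[OF finV' VV']) (auto simp: b_def)
  have norm_b: "(\<Sum>g\<in>V'. (cmod (b g))\<^sup>2) = (\<Sum>g\<in>V. (cmod (a g))\<^sup>2)"
    by (rule sum.mono_neutral_cong_right[OF finV' VV']) (auto simp: b_def)
  have "(\<Sum>f\<in>F. \<Sum>r\<in>R f. (cmod (\<Sum>g\<in>V. a g * fq_char (pairing_coeff \<alpha> f r g)))\<^sup>2)
      = (\<Sum>i\<in>Sigma F R. (cmod (\<Sum>g\<in>V'. b g * \<chi> i g))\<^sup>2)"
    using finF finR by (subst sum.Sigma) (auto simp: extend \<chi>_def intro!: sum.cong)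
  also have "\<dots> \<le> real (CARD('a) ^ 2) * real (card V') * (\<Sum>g\<in>V'. (cmod (b g))\<^sup>2)"
  proof (rule large_sieve_characters)
    show "finite (Sigma F R)" using finF finR by blast
    show "finite V'" by (rule finV')
    show "0 \<in> V'" by (simp add: V'_def quad_norm_def)
    show "x - y \<in> V'" if "x \<in> V'" "y \<in> V'" for x y
      using that norm_ball_diff by (simp add: V'_def)
    show "\<chi> i (x + y) = \<chi> i x * \<chi> i y" for i x y
      by (cases i) (simp add: \<chi>_def pairing_coeff_add fq_char_add)
    show "cmod (\<chi> i x) = 1" for i x
      by (cases i) (simp add: \<chi>_def)
    fix i assume "i \<in> Sigma F R"
    then obtain f r where i: "i = (f, r)" "f \<noteq> 0" "degree (quad_norm \<alpha> f) = Q" "r \<in> R f"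
      by (auto simp: F_def)
    have "{j \<in> Sigma F R. \<forall>g\<in>V'. \<chi> j g = \<chi> i g} =
        {(f', r') \<in> Sigma F R. \<forall>g\<in>V'. fq_char (pairing_coeff \<alpha> f' r' g) = fq_char (pairing_coeff \<alpha> f r g)}"
      by (auto simp: \<chi>_def i)
    then show "card {j \<in> Sigma F R. \<forall>g\<in>V'. \<chi> j g = \<chi> i g} \<le> CARD('a) ^ 2"
      using card_equal_chars_le[OF R, of Q N' f r] i by (simp add: F_def V'_def N'_def)
  qed
  also have "\<dots> = q ^ 2 * real (card V') * (\<Sum>g\<in>V. (cmod (a g))\<^sup>2)"
    by (simp add: norm_b q_def)
  also have "\<dots> \<le> q ^ (degree \<alpha> + 4) * (q ^ (2 * Q) + q ^ N) * (\<Sum>g\<in>V. (cmod (a g))\<^sup>2)"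
  proof (rule mult_right_mono)
    have "real (card V') \<le> q ^ (N' + 2)"
      unfolding V'_def q_def using card_norm_ball_le[of N'] by (simp only: of_nat_power[symmetric] of_nat_le_iff)
    then have "q ^ 2 * real (card V') \<le> q ^ 2 * q ^ (N' + 2)" using q by (simp add: mult_left_mono)
    also have "\<dots> = q ^ 4 * q ^ N'" by (simp add: power_add eval_nat_numeral)
    also have "q ^ N' \<le> q ^ degree \<alpha> * (q ^ (2 * Q) + q ^ N)"
    proof -
      have "q ^ N \<le> q ^ degree \<alpha> * q ^ N" "q ^ (2 * Q + degree \<alpha>) = q ^ degree \<alpha> * q ^ (2 * Q)"
        using q by (simp_all add: power_add mult.commute)
      moreover have "0 \<le> q ^ degree \<alpha> * q ^ N" "0 \<le> q ^ degree \<alpha> * q ^ (2 * Q)" using q by simp_all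
      ultimately show ?thesis
        unfolding N'_def distrib_left max_def by (auto split: if_splits)
    qed
    finally show "q ^ 2 * real (card V') \<le> q ^ (degree \<alpha> + 4) * (q ^ (2 * Q) + q ^ N)"
      using q by (simp add: power_add mult_ac)
  qed (simp add: sum_nonneg)
  finally show ?thesis by (simp add: F_def V_def q_def)
qed

end

theorem theorem3p1:
  fixes d :: nat
  assumes "odd CARD('a::finite_field)"
  shows "\<exists>C::real. C > 0 \<and>
    (\<forall>(\<alpha> :: 'a poly) (Q::nat) (N::nat) (a :: 'a poly \<times> 'a poly \<Rightarrow> complex) R.
       squarefree \<alpha> \<longrightarrow> degree \<alpha> = d \<longrightarrow>
       (odd (degree \<alpha>) \<or> (\<nexists>c. lead_coeff \<alpha> = c\<^sup>2)) \<longrightarrow>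
       (\<forall>f \<in> carrier (AA \<alpha>) - {\<zero>\<^bsub>AA \<alpha>\<^esub>}. reduced_residue_system (AA \<alpha>) f (R f)) \<longrightarrow>
       (\<Sum>f | f \<in> carrier (AA \<alpha>) - {\<zero>\<^bsub>AA \<alpha>\<^esub>} \<and> NN \<alpha> (AA_to_KKinf f) = real CARD('a) ^ Q.
         \<Sum>r \<in> R f.
           (cmod (\<Sum>g | g \<in> carrier (AA \<alpha>) \<and> AA_to_KKinf g \<in> BB \<alpha> \<zero>\<^bsub>KKinf \<alpha>\<^esub> (real N).
              a g * kinf_char (fract_to_fls (quad_trace (to_fract \<alpha>)
                (AA_to_KK g \<otimes>\<^bsub>KK \<alpha>\<^esub> AA_to_KK r
                   \<otimes>\<^bsub>KK \<alpha>\<^esub> inv\<^bsub>KK \<alpha>\<^esub> ((0, 2) \<otimes>\<^bsub>KK \<alpha>\<^esub> AA_to_KK f))))))\<^sup>2)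
       \<le> C * (real CARD('a) ^ (2 * Q) + real CARD('a) ^ N) *
         (\<Sum>g | g \<in> carrier (AA \<alpha>) \<and> AA_to_KKinf g \<in> BB \<alpha> \<zero>\<^bsub>KKinf \<alpha>\<^esub> (real N). (cmod (a g))\<^sup>2))"
proof (intro exI[of _ "real CARD('a) ^ (d + 4)"] conjI allI impI)
  show "0 < real CARD('a) ^ (d + 4)"
    using card_finite_field_gt_1[where 'a = 'a] by simp
next
  fix \<alpha> :: "'a poly" and Q N :: nat and a :: "'a poly \<times> 'a poly \<Rightarrow> complex" and R
  assume sf: "squarefree \<alpha>" and d: "degree \<alpha> = d"
    and ram: "odd (degree \<alpha>) \<or> (\<nexists>c. lead_coeff \<alpha> = c\<^sup>2)"
    and R: "\<forall>f \<in> carrier (AA \<alpha>) - {\<zero>\<^bsub>AA \<alpha>\<^esub>}. reduced_residue_system (AA \<alpha>) f (R f)"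
  have nz: "\<alpha> \<noteq> 0" using sf by auto
  have AA: "carrier (AA \<alpha>) = UNIV" "\<zero>\<^bsub>AA \<alpha>\<^esub> = 0" by (simp_all add: AA_def)
  have moduli: "{f. f \<in> carrier (AA \<alpha>) - {\<zero>\<^bsub>AA \<alpha>\<^esub>} \<and> NN \<alpha> (AA_to_KKinf f) = real CARD('a) ^ Q} =
      {f. f \<noteq> 0 \<and> degree (quad_norm \<alpha> f) = Q}"
    using NN_eq_iff[OF nz ram] by (auto simp: AA)
  have ball: "{g. g \<in> carrier (AA \<alpha>) \<and> AA_to_KKinf g \<in> BB \<alpha> \<zero>\<^bsub>KKinf \<alpha>\<^esub> (real N)} =
      {g. degree (quad_norm \<alpha> g) \<le> N}"
    by (simp add: AA AA_to_KKinf_in_BB_iff[OF nz ram])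
  have char: "kinf_char (fract_to_fls (quad_trace (to_fract \<alpha>)
      (AA_to_KK g \<otimes>\<^bsub>KK \<alpha>\<^esub> AA_to_KK r \<otimes>\<^bsub>KK \<alpha>\<^esub> inv\<^bsub>KK \<alpha>\<^esub> ((0, 2) \<otimes>\<^bsub>KK \<alpha>\<^esub> AA_to_KK f))))
      = fq_char (pairing_coeff \<alpha> f r g)" if "f \<noteq> 0" for f r g
    using fract_to_fls_quad_trace[OF two_neq_0_poly_fract[OF assms] nz, of f g r] that
    by (simp add: quad_norm_eq_0_iff[OF nz ram] kinf_char_def pairing_coeff_def residue_coeff_def)
  have "(\<Sum>f | f \<noteq> 0 \<and> degree (quad_norm \<alpha> f) = Q. \<Sum>r \<in> R f.
      (cmod (\<Sum>g | degree (quad_norm \<alpha> g) \<le> N. a g * kinf_char (fract_to_fls (quad_trace (to_fract \<alpha>)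
        (AA_to_KK g \<otimes>\<^bsub>KK \<alpha>\<^esub> AA_to_KK r \<otimes>\<^bsub>KK \<alpha>\<^esub> inv\<^bsub>KK \<alpha>\<^esub> ((0, 2) \<otimes>\<^bsub>KK \<alpha>\<^esub> AA_to_KK f))))))\<^sup>2)
    = (\<Sum>f | f \<noteq> 0 \<and> degree (quad_norm \<alpha> f) = Q. \<Sum>r \<in> R f.
      (cmod (\<Sum>g | degree (quad_norm \<alpha> g) \<le> N. a g * fq_char (pairing_coeff \<alpha> f r g)))\<^sup>2)"
    by (intro sum.cong refl) (simp add: char)
  also have "\<dots> \<le> real CARD('a) ^ (d + 4) * (real CARD('a) ^ (2 * Q) + real CARD('a) ^ N) *
      (\<Sum>g | degree (quad_norm \<alpha> g) \<le> N. (cmod (a g))\<^sup>2)"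
    unfolding d[symmetric] by (rule large_sieve_quadratic[OF nz ram]) (use R in \<open>simp add: AA\<close>)
  finally show "(\<Sum>f | f \<in> carrier (AA \<alpha>) - {\<zero>\<^bsub>AA \<alpha>\<^esub>} \<and> NN \<alpha> (AA_to_KKinf f) = real CARD('a) ^ Q.
         \<Sum>r \<in> R f.
           (cmod (\<Sum>g | g \<in> carrier (AA \<alpha>) \<and> AA_to_KKinf g \<in> BB \<alpha> \<zero>\<^bsub>KKinf \<alpha>\<^esub> (real N).
              a g * kinf_char (fract_to_fls (quad_trace (to_fract \<alpha>)
                (AA_to_KK g \<otimes>\<^bsub>KK \<alpha>\<^esub> AA_to_KK r
                   \<otimes>\<^bsub>KK \<alpha>\<^esub> inv\<^bsub>KK \<alpha>\<^esub> ((0, 2) \<otimes>\<^bsub>KK \<alpha>\<^esub> AA_to_KK f))))))\<^sup>2)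
       \<le> real CARD('a) ^ (d + 4) * (real CARD('a) ^ (2 * Q) + real CARD('a) ^ N) *
         (\<Sum>g | g \<in> carrier (AA \<alpha>) \<and> AA_to_KKinf g \<in> BB \<alpha> \<zero>\<^bsub>KKinf \<alpha>\<^esub> (real N). (cmod (a g))\<^sup>2)"
    unfolding moduli ball .
qed

end
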